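(* Let $p\in[4,\infty)$ and $\beta\in(0,2]$ be given. There exists $L>1$ such that for every bandwidth sequence $(b_n)_{n\in\mathbb{N}}\subseteq(0,1)$, the family of gamma kernel density estimators $\{\hat f_{n,b_n}:n\in\mathbb{N}\}$ satisfies \[ \liminf_{n\to\infty}\frac{R_n\{\hat f_{n,b_n},\Sigma(\beta,L)\}}{r_n\{\Sigma(\beta,L)\}} = +\infty. \]
   Context: Let $X_1,\ldots,X_n$ be iid random variables with unknown density $f$ supported on $[0,\infty)$. Gamma kernel and estimator: for $b\in(0,\infty)$ and $x\in[0,\infty)$, \[ K_b(x,t) = \frac{t^{x/b}e^{-t/b}}{b^{x/b+1}\,\Gamma(x/b+1)}\,\mathbf{1}_{[0,\infty)}(t),\quad t\in[0,\infty),\qquad \hat f_{n,b}(x) = \frac1n\sum_{i=1}^n K_b(x,X_i),\quad x\in[0,\infty), \] where $\Gamma$ is Euler's gamma function. The estimator is considered on all of $[0,\infty)$ (no truncation or renormalization). Risks: for $p\in[1,\infty)$ and measurable $g:[0,\infty)\to\mathbb{R}$, $\|g\|_p = (\int_0^\infty |g(x)|^p\,dx)^{1/p}$. For an estimator $f_n$ (based on $X_1,\dots,X_n$) of $f$, $R_n(f_n,f) = \{\mathbb{E}(\|f_n-f\|_p^p)\}^{1/p}$, the expectation being under iid sampling from $f$. For a class of densities $\mathcal{F}$, the maximal risk is $R_n(f_n,\mathcal{F}) = \sup_{f\in\mathcal{F}}R_n(f_n,f)$ and the minimax risk is $r_n(\mathcal{F}) = \inf_{f_n}R_n(f_n,\mathcal{F})$,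 the infimum being over all estimators based on $(X_1,\ldots,X_n)$. Hölder class: for $\beta\in(0,\infty)$, let $m=\sup\{\ell\in\mathbb{N}_0:\ell<\beta\}$. $\Sigma(\beta,L)$ is the set of all densities $f$ supported on $[0,1]$ that are $m$-times differentiable on $(0,\infty)$ (so a jump is allowed at $0$ but not at $1$) and such that \[ \max_{0\le k\le m}\sup_{u\in(0,\infty)}|f^{(k)}(u)|\le L\quad\text{and}\quad \sup_{u,v\in(0,\infty),\,u\ne v}\frac{|f^{(m)}(u)-f^{(m)}(v)|}{|u-v|^{\beta-m}}\le L, \] where $f^{(k)}$ is the $k$th derivative and $f^{(0)}=f$. Known fact taken from the literature in the paper: for every fixed $\beta\in(0,\infty)$ and $p\in[1,\infty)$, provided $L$ is sufficiently large depending on $\beta$, $r_n\{\Sigma(\beta,L)\}\asymp n^{-\beta/(2\beta+1)}$ as $n\to\infty$. *)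

theory Defs
  imports "HOL-Probability.Probability"
begin

text \<open>Real powers of extended nonnegative reals, used for exponents \<open>r > 0\<close> only.\<close>

definition ennpowr :: "ennreal \<Rightarrow> real \<Rightarrow> ennreal" where
  "ennpowr a r = (if a = \<top> then \<top> else ennreal (enn2real a powr r))"

text \<open>The case split gives \<open>t\<^sup>0 = 1\<close> also at \<open>t = 0\<close>, where \<^prop>\<open>(0::real) powr 0 = 0\<close>.\<close>

definition gamma_kernel :: "real \<Rightarrow> real \<Rightarrow> real \<Rightarrow> real" where
  "gamma_kernel b x t =
     (if x = 0 then 1 else t powr (x / b)) * exp (- t / b) / (b powr (x / b + 1) * Gamma (x / b + 1))
       * indicator {0..} t"

text \<open>A sample \<open>(X\<^sub>1, \<dots>, X\<^sub>n)\<close> is a function on \<open>{1..n}\<close>; its law under iid sampling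
  from \<open>f\<close> is \<open>iid_law n f\<close>. An estimator maps a sample to a function on \<open>[0,\<infinity>)\<close>; its
  values at negative arguments never enter the risk.\<close>

definition gamma_kde :: "nat \<Rightarrow> real \<Rightarrow> (nat \<Rightarrow> real) \<Rightarrow> real \<Rightarrow> real" where
  "gamma_kde n b X x = (1 / real n) * (\<Sum>i = 1..n. gamma_kernel b x (X i))"

definition iid_law :: "nat \<Rightarrow> (real \<Rightarrow> real) \<Rightarrow> (nat \<Rightarrow> real) measure" where
  "iid_law n f = (\<Pi>\<^sub>M i\<in>{1..n}. density lborel (\<lambda>x. ennreal (f x)))"

definition estimators :: "nat \<Rightarrow> ((nat \<Rightarrow> real) \<Rightarrow> real \<Rightarrow> real) set" where
  "estimators n =
     {T. (\<lambda>(X, x). T X x) \<in> borel_measurable ((\<Pi>\<^sub>M i\<in>{1..n}. borel) \<Otimes>\<^sub>M borel)}"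

definition Lp_norm :: "real \<Rightarrow> (real \<Rightarrow> real) \<Rightarrow> ennreal" where
  "Lp_norm p g = ennpowr (\<integral>\<^sup>+x\<in>{0..}. ennreal (\<bar>g x\<bar> powr p) \<partial>lborel) (1 / p)"

definition risk ::
  "real \<Rightarrow> nat \<Rightarrow> ((nat \<Rightarrow> real) \<Rightarrow> real \<Rightarrow> real) \<Rightarrow> (real \<Rightarrow> real) \<Rightarrow> ennreal" where
  "risk p n T f =
     ennpowr (\<integral>\<^sup>+X. ennpowr (Lp_norm p (\<lambda>x. T X x - f x)) p \<partial>iid_law n f) (1 / p)"

definition max_risk ::
  "real \<Rightarrow> nat \<Rightarrow> ((nat \<Rightarrow> real) \<Rightarrow> real \<Rightarrow> real) \<Rightarrow> (real \<Rightarrow> real) set \<Rightarrow> ennreal" where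
  "max_risk p n T F = (SUP f\<in>F. risk p n T f)"

definition minimax_risk :: "real \<Rightarrow> nat \<Rightarrow> (real \<Rightarrow> real) set \<Rightarrow> ennreal" where
  "minimax_risk p n F = (INF T\<in>estimators n. max_risk p n T F)"

text \<open>As \<open>a / 0 = \<infinity>\<close> in \<^typ>\<open>ennreal\<close> for \<open>a > 0\<close>, dividing by the minimax risk is meaningful only
  where that risk is positive. This fails for degenerate classes: for \<open>0 < \<beta> \<le> 1\<close> and \<open>L = \<beta> + 1\<close>, the
  class \<open>holder_class \<beta> L\<close> below consists only of the density \<open>(\<beta> + 1) (1 - u)\<^sup>\<beta>\<close>, up to its
  value at \<open>0\<close>, and its minimax risk vanishes.\<close>

definition prob_density :: "(real \<Rightarrow> real) \<Rightarrow> bool" where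
  "prob_density f \<longleftrightarrow>
     f \<in> borel_measurable borel \<and> (\<forall>x. 0 \<le> f x) \<and> (\<integral>\<^sup>+x. ennreal (f x) \<partial>lborel) = 1"

definition holder_order :: "real \<Rightarrow> nat" where
  "holder_order \<beta> = Sup {l. real l < \<beta>}"

text \<open>The suprema in the definition of the class are rendered as pointwise bounds, since
  \<^const>\<open>Sup\<close> on \<^typ>\<open>real\<close> is unspecified for unbounded sets.\<close>

definition holder_class :: "real \<Rightarrow> real \<Rightarrow> (real \<Rightarrow> real) set" where
  "holder_class \<beta> L =
     (let m = holder_order \<beta> in
      {f. prob_density f \<and> (\<forall>x. x \<notin> {0..1} \<longrightarrow> f x = 0)
        \<and> (\<forall>k<m. \<forall>u>0. (deriv ^^ k) f field_differentiable (at u))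
        \<and> (\<forall>k\<le>m. \<forall>u>0. \<bar>(deriv ^^ k) f u\<bar> \<le> L)
        \<and> (\<forall>u>0. \<forall>v>0. u \<noteq> v \<longrightarrow>
             \<bar>(deriv ^^ m) f u - (deriv ^^ m) f v\<bar> / \<bar>u - v\<bar> powr (\<beta> - real m) \<le> L)})"

end

theory Submission
  imports Defs
begin

text \<open>
  The estimator is too variable near the origin. At a point \<open>x\<close> the gamma kernel with bandwidth
  \<open>b\<close> is a probability density with standard deviation about \<open>sqrt (b x)\<close>, so
  the variance of the estimator there is about \<open>1 / (n sqrt (b x))\<close>. Its power \<open>p / 2\<close>
  contains \<open>x^(-p/4)\<close>, which is not integrable at \<open>0\<close> once \<open>p \<ge> 4\<close>. This description of the
  variance is valid for \<open>x \<ge> b\<close>, and integration from \<open>b\<close> on shows that for small \<open>b\<close> the risk at a density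
  bounded below near \<open>0\<close> is at least of order \<open>(n sqrt b)^(-1/2) (ln (1/b))^(1/p)\<close> (lemma \<open>gamma_kde_variance_lower_bound\<close>).

  On the other hand the kernel averages over a window of width of order \<open>sqrt b\<close> in the middle of the
  unit interval, so it destroys oscillations that are much faster than \<open>1 / sqrt b\<close>. The class
  contains a fixed density and also its perturbations by such oscillations with
  amplitude of order \<open>b^(\<beta>/2)\<close>. For one of the two densities the bias is therefore at least of order
  \<open>b^(\<beta>/2)\<close>, for every bandwidth in \<open>(0,1)\<close> (lemma \<open>gamma_kde_bias_lower_bound\<close>).

  If \<open>sqrt b\<close> is a large multiple of \<open>n^(-1/(2\<beta>+1))\<close>, the bias exceeds a large multiple
  of \<open>n^(-\<beta>/(2\<beta>+1))\<close>. Otherwise \<open>b\<close> tends to \<open>0\<close> at a polynomial rate, and the stochastic error exceeds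
  \<open>n^(-\<beta>/(2\<beta>+1))\<close> by a power of \<open>ln n\<close>. In both cases the ratio to
  \<open>n^(-\<beta>/(2\<beta>+1))\<close> is as large as desired, uniformly in \<open>b\<close> (lemma \<open>gamma_kde_rate\<close>).

  It remains to compare with the minimax risk. It is of order at most \<open>n^(-\<beta>/(2\<beta>+1))\<close>
  (lemma \<open>minimax_risk_upper_bound\<close>): a kernel estimator that looks only to the right of the point
  of estimation never sees the jump at \<open>0\<close>, and the class is smooth across \<open>1\<close>. It is
  positive (lemma \<open>minimax_risk_pos\<close>), since the laws of a sample under two members of the class
  dominate each other up to a constant.
\<close>

section \<open>Risks and iid laws\<close>

lemma ennpowr_ennreal: "0 \<le> a \<Longrightarrow> ennpowr (ennreal a) r = ennreal (a powr r)"
  by (simp add: ennpowr_def)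

lemma ennpowr_inverse:
  assumes "0 < p" shows "ennpowr (ennpowr a (1 / p)) p = a"
proof (cases a)
  case (real r)
  then show ?thesis using assms by (simp add: ennpowr_ennreal powr_powr)
qed (simp add: ennpowr_def)

lemma ennpowr_mono:
  assumes "a \<le> b" "0 < r" shows "ennpowr a r \<le> ennpowr b r"
proof (cases "b = \<top>")
  case True
  then show ?thesis by (simp add: ennpowr_def)
next
  case False
  then obtain b' where b: "b = ennreal b'" "0 \<le> b'" by (cases b) auto
  with assms obtain a' where a: "a = ennreal a'" "0 \<le> a'" by (cases a) (auto simp: top_unique)
  then show ?thesis using a b assms
    by (simp add: ennpowr_ennreal powr_mono2)
qed

text \<open>
  Tonelli's theorem turns the \<open>p\<close>-th power of the risk into the integral of this function over
  \<open>[0,\<infinity>)\<close>, so bias and variance can be studied at one \<open>x\<close> at a time.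
\<close>

definition pointwise_risk ::
  "real \<Rightarrow> nat \<Rightarrow> ((nat \<Rightarrow> real) \<Rightarrow> real \<Rightarrow> real) \<Rightarrow> (real \<Rightarrow> real) \<Rightarrow> real \<Rightarrow> ennreal" where
  "pointwise_risk p n T f x = (\<integral>\<^sup>+X. ennreal (\<bar>T X x - f x\<bar> powr p) \<partial>iid_law n f)"

lemma prob_space_density:
  assumes "prob_density f" shows "prob_space (density lborel (\<lambda>x. ennreal (f x)))"
  using assms by (auto intro!: prob_spaceI simp: emeasure_density prob_density_def)

lemma product_prob_space_density:
  assumes "prob_density f" shows "product_prob_space (\<lambda>i. density lborel (\<lambda>x. ennreal (f x)))"
  by (simp add: product_prob_space_def product_prob_space_axioms_def product_sigma_finite_def
      prob_space_density[OF assms] prob_space_imp_sigma_finite)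

lemma prob_space_iid_law: "prob_density f \<Longrightarrow> prob_space (iid_law n f)"
  unfolding iid_law_def by (intro prob_space_PiM prob_space_density)

lemma sets_iid_law [measurable_cong]: "sets (iid_law n f) = sets (\<Pi>\<^sub>M i\<in>{1..n}. borel)"
  unfolding iid_law_def by (intro sets_PiM_cong) auto

lemma risk_eq:
  assumes "0 < p"
  shows "risk p n T f = ennpowr (\<integral>\<^sup>+X. (\<integral>\<^sup>+x\<in>{0..}. ennreal (\<bar>T X x - f x\<bar> powr p) \<partial>lborel)
    \<partial>iid_law n f) (1 / p)"
  unfolding risk_def Lp_norm_def ennpowr_inverse[OF assms] ..

lemma measurable_loss:
  assumes T: "T \<in> estimators n" and [measurable]: "f \<in> borel_measurable borel"
  shows "(\<lambda>(X, x). ennreal (\<bar>T X x - f x\<bar> powr p) * indicator {0..} x)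
    \<in> borel_measurable ((\<Pi>\<^sub>M i\<in>{1..n}. borel) \<Otimes>\<^sub>M borel)"
proof -
  have [measurable]: "(\<lambda>z. T (fst z) (snd z)) \<in> borel_measurable ((\<Pi>\<^sub>M i\<in>{1..n}. borel) \<Otimes>\<^sub>M borel)"
    using T by (simp add: estimators_def case_prod_beta)
  show ?thesis unfolding case_prod_beta by measurable
qed

lemma risk_eq_pointwise_risk:
  assumes T: "T \<in> estimators n" and f: "prob_density f" and p: "0 < p"
  shows "risk p n T f = ennpowr (\<integral>\<^sup>+x\<in>{0..}. pointwise_risk p n T f x \<partial>lborel) (1 / p)"
proof -
  have fm [measurable]: "f \<in> borel_measurable borel" using f by (simp add: prob_density_def)
  interpret P: prob_space "iid_law n f" by (rule prob_space_iid_law[OF f])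
  interpret pair_sigma_finite "iid_law n f" "lborel :: real measure" ..
  have m: "(\<lambda>(X, x). ennreal (\<bar>T X x - f x\<bar> powr p) * indicator {0..} x)
      \<in> borel_measurable (iid_law n f \<Otimes>\<^sub>M lborel)"
    using measurable_loss[OF T fm] by (simp cong: measurable_cong_sets sets_pair_measure_cong add: sets_iid_law)
  have "(\<integral>\<^sup>+X. (\<integral>\<^sup>+x\<in>{0..}. ennreal (\<bar>T X x - f x\<bar> powr p) \<partial>lborel) \<partial>iid_law n f)
     = (\<integral>\<^sup>+x. (\<integral>\<^sup>+X. ennreal (\<bar>T X x - f x\<bar> powr p) * indicator {0..} x \<partial>iid_law n f) \<partial>lborel)"
    by (rule Fubini'[OF m, symmetric])
  also have "\<dots> = (\<integral>\<^sup>+x\<in>{0..}. pointwise_risk p n T f x \<partial>lborel)"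
  proof (intro nn_integral_cong)
    fix x :: real
    show "(\<integral>\<^sup>+X. ennreal (\<bar>T X x - f x\<bar> powr p) * indicator {0..} x \<partial>iid_law n f)
        = pointwise_risk p n T f x * indicator {0..} x"
      by (cases "x \<ge> 0") (auto simp: pointwise_risk_def)
  qed
  finally show ?thesis by (simp add: risk_eq[OF p])
qed

lemma measurable_pointwise_risk:
  assumes T: "T \<in> estimators n" and f: "prob_density f"
  shows "(\<lambda>x. pointwise_risk p n T f x * indicator {0..} x) \<in> borel_measurable lborel"
proof -
  have fm [measurable]: "f \<in> borel_measurable borel" using f by (simp add: prob_density_def)
  interpret P: prob_space "iid_law n f" by (rule prob_space_iid_law[OF f])
  have [measurable]: "(\<lambda>z. T (fst z) (snd z)) \<in> borel_measurable (iid_law n f \<Otimes>\<^sub>M borel)"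
    using T by (simp add: estimators_def case_prod_beta cong: measurable_cong_sets sets_pair_measure_cong add: sets_iid_law)
  have "(\<lambda>x. \<integral>\<^sup>+X. ennreal (\<bar>T X x - f x\<bar> powr p) \<partial>iid_law n f) \<in> borel_measurable borel"
  proof (rule P.borel_measurable_nn_integral)
    have "(\<lambda>z. T (snd z) (fst z)) \<in> borel_measurable (borel \<Otimes>\<^sub>M iid_law n f)"
      using measurable_compose[OF measurable_pair_swap' \<open>(\<lambda>z. T (fst z) (snd z)) \<in> _\<close>]
      by (simp add: case_prod_beta)
    then show "(\<lambda>(x, X). ennreal (\<bar>T X x - f x\<bar> powr p)) \<in> borel_measurable (borel \<Otimes>\<^sub>M iid_law n f)"
      by (simp add: case_prod_beta)
  qed
  then show ?thesis by (simp add: pointwise_risk_def)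
qed

lemma max_risk_lower_bound:
  assumes T: "T \<in> estimators n" and F: "f \<in> F" "prob_density f" and p: "0 < p" and "0 \<le> c"
    and le: "ennreal (c powr p) \<le> (\<integral>\<^sup>+x\<in>{0..}. pointwise_risk p n T f x \<partial>lborel)"
  shows "ennreal c \<le> max_risk p n T F"
proof -
  have "ennreal c = ennpowr (ennreal (c powr p)) (1 / p)"
    using p \<open>0 \<le> c\<close> by (simp add: ennpowr_ennreal powr_powr)
  also have "\<dots> \<le> risk p n T f"
    unfolding risk_eq_pointwise_risk[OF T F(2) p] using le p by (intro ennpowr_mono) auto
  also have "\<dots> \<le> max_risk p n T F" unfolding max_risk_def using F by (intro SUP_upper)
  finally show ?thesis .
qed

text \<open>
  The larger of two risks is at least their mean, so a bound for the sum of the pointwise risks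
  of two densities is enough.
\<close>

lemma max_risk_lower_bound_pair:
  assumes T: "T \<in> estimators n" and F: "f \<in> F" "prob_density f" and G: "g \<in> F" "prob_density g"
    and p: "0 < p" and "0 \<le> c"
    and le: "ennreal (2 * c powr p)
      \<le> (\<integral>\<^sup>+x\<in>{0..}. (pointwise_risk p n T f x + pointwise_risk p n T g x) \<partial>lborel)"
  shows "ennreal c \<le> max_risk p n T F"
proof -
  have "ennreal (c powr p) + ennreal (c powr p) = ennreal (2 * c powr p)"
    by (simp add: ennreal_plus[symmetric] del: ennreal_plus)
  also have "\<dots> \<le> (\<integral>\<^sup>+x\<in>{0..}. pointwise_risk p n T f x \<partial>lborel)
      + (\<integral>\<^sup>+x\<in>{0..}. pointwise_risk p n T g x \<partial>lborel)"
    using le nn_integral_add[OF measurable_pointwise_risk[OF T F(2)] measurable_pointwise_risk[OF T G(2)]]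
    by (simp add: distrib_right)
  finally have *: "ennreal (c powr p) + ennreal (c powr p)
    \<le> (\<integral>\<^sup>+x\<in>{0..}. pointwise_risk p n T f x \<partial>lborel)
      + (\<integral>\<^sup>+x\<in>{0..}. pointwise_risk p n T g x \<partial>lborel)" .
  have "ennreal (c powr p) \<le> (\<integral>\<^sup>+x\<in>{0..}. pointwise_risk p n T f x \<partial>lborel) \<or>
      ennreal (c powr p) \<le> (\<integral>\<^sup>+x\<in>{0..}. pointwise_risk p n T g x \<partial>lborel)"
  proof (rule ccontr)
    assume "\<not> ?thesis"
    then have "(\<integral>\<^sup>+x\<in>{0..}. pointwise_risk p n T f x \<partial>lborel)
      + (\<integral>\<^sup>+x\<in>{0..}. pointwise_risk p n T g x \<partial>lborel) < ennreal (c powr p) + ennreal (c powr p)"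
      by (intro add_strict_mono) auto
    with * show False by simp
  qed
  then show ?thesis
    using max_risk_lower_bound[OF T F p \<open>0 \<le> c\<close>] max_risk_lower_bound[OF T G p \<open>0 \<le> c\<close>] by blast
qed

lemma max_risk_upper_bound:
  assumes T: "T \<in> estimators n" and p: "0 < p" and "0 \<le> c"
    and F: "\<And>f. f \<in> F \<Longrightarrow> prob_density f"
    and le: "\<And>f. f \<in> F \<Longrightarrow>
      (\<integral>\<^sup>+x\<in>{0..}. pointwise_risk p n T f x \<partial>lborel) \<le> ennreal (c powr p)"
  shows "max_risk p n T F \<le> ennreal c"
  unfolding max_risk_def
proof (rule SUP_least)
  fix f assume f: "f \<in> F"
  have "risk p n T f \<le> ennpowr (ennreal (c powr p)) (1 / p)"
    unfolding risk_eq_pointwise_risk[OF T F[OF f] p] using le[OF f] p by (intro ennpowr_mono) auto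
  also have "\<dots> = ennreal c" using p \<open>0 \<le> c\<close> by (simp add: ennpowr_ennreal powr_powr)
  finally show "risk p n T f \<le> ennreal c" .
qed

section \<open>Two densities of the Hoelder class\<close>

lemma holder_order_eq:
  assumes "0 < \<beta>" "\<beta> \<le> 2"
  shows "holder_order \<beta> = (if \<beta> \<le> 1 then 0 else 1)"
proof -
  have "{l. real l < \<beta>} = (if \<beta> \<le> 1 then {0} else {0, 1})"
  proof -
    have "l < 2" if "real l < \<beta>" for l using that assms by linarith
    then show ?thesis using assms by (auto simp: less_2_cases_iff)
  qed
  then show ?thesis by (simp add: holder_order_def cSup_eq_Max)
qed

text \<open>
  The conditions that define the class for \<open>\<beta> \<le> 2\<close>, with an explicit derivative and without
  those on densities. In this form they are additive in \<open>f\<close> and \<open>A\<close>, so the base density and its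
  perturbation can be treated separately.
\<close>

definition holder_bounds :: "real \<Rightarrow> real \<Rightarrow> (real \<Rightarrow> real) \<Rightarrow> (real \<Rightarrow> real) \<Rightarrow> bool" where
  "holder_bounds \<beta> A f D \<longleftrightarrow>
     (\<forall>u>0. (f has_real_derivative D u) (at u) \<and> \<bar>f u\<bar> \<le> A) \<and>
     (\<beta> \<le> 1 \<longrightarrow> (\<forall>u>0. \<forall>v>0. \<bar>f u - f v\<bar> \<le> A * \<bar>u - v\<bar> powr \<beta>)) \<and>
     (1 < \<beta> \<longrightarrow> (\<forall>u>0. \<bar>D u\<bar> \<le> A) \<and> (\<forall>u>0. \<forall>v>0. \<bar>D u - D v\<bar> \<le> A * \<bar>u - v\<bar> powr (\<beta> - 1)))"

lemma holder_bounds_mono: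
  assumes "holder_bounds \<beta> A f D" "A \<le> B" shows "holder_bounds \<beta> B f D"
proof -
  have *: "A * y powr z \<le> B * y powr z" for y z :: real
    using mult_right_mono[OF \<open>A \<le> B\<close>, of "y powr z"] by simp
  show ?thesis unfolding holder_bounds_def
    using assms unfolding holder_bounds_def by (intro conjI allI impI) (simp_all add: order_trans[OF _ *] order_trans[OF _ \<open>A \<le> B\<close>])
qed

lemma holder_bounds_add:
  assumes f: "holder_bounds \<beta> A f D" and g: "holder_bounds \<beta> B g E"
  shows "holder_bounds \<beta> (A + B) (\<lambda>u. f u + g u) (\<lambda>u. D u + E u)"
proof -
  have *: "\<bar>(x + x') - (y + y')\<bar> \<le> (A + B) * z"
    if "\<bar>x - y\<bar> \<le> A * z" "\<bar>x' - y'\<bar> \<le> B * z" for x y x' y' z :: real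
    using that by (simp add: distrib_right)
  have **: "\<bar>x + y\<bar> \<le> A + B" if "\<bar>x\<bar> \<le> A" "\<bar>y\<bar> \<le> B" for x y :: real using that by linarith
  note fg = f[unfolded holder_bounds_def] g[unfolded holder_bounds_def]
  show ?thesis unfolding holder_bounds_def
    by (intro conjI allI impI; (rule DERIV_add * **); use fg in simp)
qed

lemma holder_class_memI:
  assumes \<beta>: "0 < \<beta>" "\<beta> \<le> 2" and f: "prob_density f" "\<And>x. x \<notin> {0..1} \<Longrightarrow> f x = 0"
    and b: "holder_bounds \<beta> L f D"
  shows "f \<in> holder_class \<beta> L"
proof -
  have d: "f field_differentiable (at u)" "deriv f u = D u" if "u > 0" for u
    using b that unfolding holder_bounds_def
    by (auto simp: field_differentiable_def intro!: DERIV_imp_deriv)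
  show ?thesis
  proof (cases "\<beta> \<le> 1")
    case True
    then have "holder_order \<beta> = 0" using holder_order_eq[OF \<beta>] by simp
    then show ?thesis using b f True unfolding holder_class_def holder_bounds_def Let_def
      by (auto simp: divide_le_eq)
  next
    case False
    then have "holder_order \<beta> = Suc 0" using holder_order_eq[OF \<beta>] by simp
    then show ?thesis using b f False d unfolding holder_class_def holder_bounds_def Let_def
      by (auto simp: divide_le_eq le_Suc_eq)
  qed
qed

text \<open>
  The first bound is the better one for \<open>w d \<ge> 1\<close> and the second for \<open>w d \<le> 1\<close>. For a function that
  oscillates with frequency \<open>w\<close>, these are the trivial bound on an increment and the one from the
  derivative.
\<close>

lemma powr_interpolation:
  fixes \<gamma> w d A y :: real
  assumes "0 \<le> \<gamma>" "\<gamma> \<le> 1" "0 < w" "0 < d" "0 \<le> A"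
    and y: "y \<le> A * w powr (- \<gamma>)" "y \<le> A * w powr (1 - \<gamma>) * d"
  shows "y \<le> A * d powr \<gamma>"
proof (cases "w * d \<ge> 1")
  case True
  have "w powr (- \<gamma>) = (1 / w) powr \<gamma>" using assms by (simp add: powr_minus_divide powr_divide)
  also have "\<dots> \<le> d powr \<gamma>" using assms True by (intro powr_mono2) (auto simp: field_simps)
  finally show ?thesis using y(1) \<open>0 \<le> A\<close> by (meson mult_left_mono order_trans)
next
  case False
  have "w powr (1 - \<gamma>) * d = (w * d) powr (1 - \<gamma>) * d powr \<gamma>"
    using assms by (simp add: powr_mult powr_diff)
  also have "\<dots> \<le> 1 * d powr \<gamma>" using False assms by (intro mult_right_mono powr_le1) auto
  finally have "A * (w powr (1 - \<gamma>) * d) \<le> A * d powr \<gamma>" using \<open>0 \<le> A\<close> by (simp add: mult_left_mono)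
  then show ?thesis using y(2) by (simp add: mult.assoc)
qed

text \<open>
  Differentiation of a function of frequency \<open>w\<close> costs a factor \<open>w\<close>. With
  amplitude \<open>w powr (- \<beta>)\<close> the Hoelder condition of order \<open>\<beta>\<close> thus holds with a constant that
  does not depend on \<open>w\<close>.
\<close>

lemma holder_bounds_of_frequency:
  assumes \<beta>: "0 < \<beta>" "\<beta> \<le> 2" and w: "1 \<le> w" and A: "0 \<le> A"
    and d: "\<And>u. 0 < u \<Longrightarrow> (f has_real_derivative D u) (at u)"
    and f: "\<And>u. 0 < u \<Longrightarrow> \<bar>f u\<bar> \<le> A * w powr (- \<beta>)"
    and D: "\<And>u. 0 < u \<Longrightarrow> \<bar>D u\<bar> \<le> A * w powr (1 - \<beta>)"
    and D2: "\<And>u v. 0 < u \<Longrightarrow> 0 < v \<Longrightarrow> \<bar>D u - D v\<bar> \<le> A * w powr (2 - \<beta>) * \<bar>u - v\<bar>"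
  shows "holder_bounds \<beta> (2 * A) f D"
proof -
  have small: "A * w powr c \<le> A" if "c \<le> 0" for c
    using powr_mono[OF that w] w A by (simp add: mult_left_le)
  have lip: "\<bar>f u - f v\<bar> \<le> A * w powr (1 - \<beta>) * \<bar>u - v\<bar>" if "0 < u" "0 < v" for u v
  proof -
    have "norm (f u - f v) \<le> A * w powr (1 - \<beta>) * norm (u - v)"
      by (rule field_differentiable_bound[of "{0<..}" f D])
        (use that D in \<open>auto intro: has_field_derivative_at_within d\<close>)
    then show ?thesis by simp
  qed
  have h1: "\<bar>f u - f v\<bar> \<le> 2 * A * \<bar>u - v\<bar> powr \<beta>" if "\<beta> \<le> 1" "0 < u" "0 < v" for u v
  proof (cases "u = v")
    case False
    have "\<bar>f u - f v\<bar> \<le> 2 * A * w powr (- \<beta>)" using f[OF that(2)] f[OF that(3)] by linarith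
    moreover have "\<bar>f u - f v\<bar> \<le> 2 * A * w powr (1 - \<beta>) * \<bar>u - v\<bar>"
    proof -
      have "0 \<le> A * w powr (1 - \<beta>) * \<bar>u - v\<bar>" using A by simp
      then show ?thesis using lip[OF that(2,3)] by simp
    qed
    ultimately show ?thesis using False that \<beta> w A by - (rule powr_interpolation[where w=w], auto)
  qed (use A in auto)
  have h2: "\<bar>D u - D v\<bar> \<le> 2 * A * \<bar>u - v\<bar> powr (\<beta> - 1)" if "1 < \<beta>" "0 < u" "0 < v" for u v
  proof (cases "u = v")
    case False
    have "\<bar>D u - D v\<bar> \<le> 2 * A * w powr (- (\<beta> - 1))" using D[OF that(2)] D[OF that(3)] by simp
    moreover have "\<bar>D u - D v\<bar> \<le> 2 * A * w powr (1 - (\<beta> - 1)) * \<bar>u - v\<bar>"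
    proof -
      have "0 \<le> A * w powr (2 - \<beta>) * \<bar>u - v\<bar>" using A by simp
      then show ?thesis using D2[OF that(2,3)] by simp
    qed
    ultimately show ?thesis using False that \<beta> w A by - (rule powr_interpolation[where w=w], auto)
  qed (use A in auto)
  have "\<bar>f u\<bar> \<le> 2 * A" if "0 < u" for u using f[OF that] small[of "-\<beta>"] \<beta> A by linarith
  moreover have "\<bar>D u\<bar> \<le> 2 * A" if "0 < u" "1 < \<beta>" for u
    using D[OF that(1)] small[of "1-\<beta>"] that A by linarith
  ultimately show ?thesis unfolding holder_bounds_def using h1 h2 d by auto
qed

lemma has_real_derivative_cutoff:
  fixes F :: "real \<Rightarrow> real"
  assumes d: "\<And>u. (F has_real_derivative D u) (at u)" and c: "F c = 0" "D c = 0"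
  shows "((\<lambda>u. if u < c then F u else 0) has_real_derivative (if u < c then D u else 0)) (at u)"
proof -
  consider "u < c" | "u = c" | "u > c" by linarith
  then show ?thesis
  proof cases
    case 1
    then show ?thesis
      by (auto intro!: has_field_derivative_transform_within_open[OF d, where S = "{..<c}"])
  next
    case 2
    have "((\<lambda>x. (F x - F c) / (x - c)) \<longlongrightarrow> 0) (at c)"
      using d[of c] c by (simp add: has_field_derivative_iff)
    then have "((\<lambda>x. ((if x < c then F x else 0) - (if c < c then F c else 0)) / (x - c)) \<longlongrightarrow> 0) (at c)"
      by (rule Lim_null_comparison[rotated, OF tendsto_norm_zero]) (auto simp: c)
    then show ?thesis using 2 by (simp add: has_field_derivative_iff)
  next
    case 3
    then show ?thesis
      by (auto intro!: has_field_derivative_transform_within_open[OF DERIV_const, where S = "{c<..}"])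
  qed
qed

lemma cutoff_lipschitz:
  fixes F :: "real \<Rightarrow> real"
  assumes d: "\<And>u. (F has_real_derivative D u) (at u)" and c: "F c = 0"
    and b: "\<And>u. 0 < u \<Longrightarrow> u \<le> c \<Longrightarrow> \<bar>D u\<bar> \<le> B" and uv: "0 < u" "0 < v" and B: "0 \<le> B"
  shows "\<bar>(if u < c then F u else 0) - (if v < c then F v else 0)\<bar> \<le> B * \<bar>u - v\<bar>"
proof -
  have *: "\<bar>F u - F v\<bar> \<le> B * \<bar>u - v\<bar>" if "0 < u" "0 < v" "u \<le> c" "v \<le> c" for u v
  proof -
    have "norm (F u - F v) \<le> B * norm (u - v)"
      by (rule field_differentiable_bound[of "{0<..c}" F D])
        (use that b in \<open>auto intro: has_field_derivative_at_within d\<close>)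
    then show ?thesis by simp
  qed
  have **: "\<bar>F u\<bar> \<le> B * \<bar>u - v\<bar>" if "0 < u" "u < c" "c \<le> v" for u v
  proof -
    have "\<bar>F u\<bar> \<le> B * \<bar>u - c\<bar>" using *[of u c] that c by simp
    also have "\<dots> \<le> B * \<bar>u - v\<bar>" using that B by (intro mult_left_mono) auto
    finally show ?thesis .
  qed
  show ?thesis
    using *[OF uv] **[of u v] **[of v u] uv B by (auto simp: abs_minus_commute)
qed

text \<open>
  This density and the wiggle below vanish at the right end of their support together with their
  first derivative, and the derivative is Lipschitz; for the wiggle this uses
  \<open>sin (w / 2) = 0\<close>. This is the smoothness required for \<open>\<beta> = 2\<close>. The jump at \<open>0\<close> is permitted
  by the class.
\<close>

definition base_density :: "real \<Rightarrow> real" where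
  "base_density x = (if 0 \<le> x \<and> x < 1 then 4 * (1 - x) ^ 3 else 0)"

definition wiggle :: "real \<Rightarrow> real \<Rightarrow> real \<Rightarrow> real" where
  "wiggle \<beta> w x = (if 0 \<le> x \<and> x < 1 / 2 then w powr (- \<beta>) / 4 * sin (w * x) ^ 3 else 0)"

lemma measurable_base_density [measurable]: "base_density \<in> borel_measurable borel"
  unfolding base_density_def by measurable

lemma measurable_wiggle [measurable]: "wiggle \<beta> w \<in> borel_measurable borel"
  unfolding wiggle_def by measurable

lemma base_density_nonneg: "0 \<le> base_density x" by (simp add: base_density_def)

lemma base_density_le: "base_density x \<le> 4"
  by (simp add: base_density_def power_le_one)

lemma base_density_ge: "1 / 2 \<le> base_density x" if "0 \<le> x" "x \<le> 1 / 2"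
proof -
  have "(1/2) ^ 3 \<le> (1 - x) ^ 3" using that by (intro power_mono) auto
  then show ?thesis using that by (simp add: base_density_def power_divide)
qed

lemma holder_bounds_base_density:
  assumes "0 < \<beta>" "\<beta> \<le> 2"
  shows "\<exists>D. holder_bounds \<beta> 48 base_density D"
proof -
  define D where "D u = (if u < 1 then - 12 * (1 - u) ^ 2 else (0::real))" for u :: real
  have e: "base_density u = (if u < 1 then 4 * (1 - u) ^ 3 else 0)" if "0 < u" for u
    using that by (simp add: base_density_def)
  have "(base_density has_real_derivative D u) (at u)" if "0 < u" for u
  proof (rule has_field_derivative_transform_within_open)
    show "((\<lambda>u. if u < 1 then 4 * (1 - u) ^ 3 else 0) has_real_derivative D u) (at u)"
      unfolding D_def
      by (rule has_real_derivative_cutoff) (auto intro!: derivative_eq_intros)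
  qed (use that e in \<open>auto intro: open_greaterThan[of 0]\<close>)
  moreover have "\<bar>base_density u\<bar> \<le> 24 * 1 powr (- \<beta>)" for u
    using base_density_nonneg[of u] base_density_le[of u] by simp
  moreover have "\<bar>D u\<bar> \<le> 24 * 1 powr (1 - \<beta>)" if "0 < u" for u
  proof -
    have "\<bar>1 - u\<bar>^2 \<le> 1" if "u < 1" using that \<open>0 < u\<close> by (intro power_le_one) auto
    then show ?thesis by (auto simp: D_def)
  qed
  moreover have "\<bar>D u - D v\<bar> \<le> 24 * 1 powr (2 - \<beta>) * \<bar>u - v\<bar>" if "0 < u" "0 < v" for u v
  proof -
    have "\<bar>D u - D v\<bar> \<le> 24 * \<bar>u - v\<bar>" unfolding D_def
      by (rule cutoff_lipschitz[where D = "\<lambda>u. 24 * (1 - u)"])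
        (use that in \<open>auto intro!: derivative_eq_intros\<close>)
    then show ?thesis by simp
  qed
  ultimately have "holder_bounds \<beta> (2 * 24) base_density D"
    by (intro holder_bounds_of_frequency[where w = 1] assms) auto
  then show ?thesis by auto
qed

lemma holder_bounds_wiggle:
  assumes \<beta>: "0 < \<beta>" "\<beta> \<le> 2" and w: "1 \<le> w" "sin (w / 2) = 0"
  shows "\<exists>D. holder_bounds \<beta> 6 (wiggle \<beta> w) D"
proof -
  define a where "a = w powr (- \<beta>) / 4"
  have a: "0 \<le> a" by (simp add: a_def)
  define F where "F u = a * sin (w * u) ^ 3" for u
  define F1 where "F1 u = a * w * (3 * sin (w * u) ^ 2 * cos (w * u))" for u
  define F2 where "F2 u = a * w * w * (6 * sin (w * u) * cos (w * u) ^ 2 - 3 * sin (w * u) ^ 3)" for u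
  define D where "D u = (if u < 1/2 then F1 u else 0)" for u
  have dF: "(F has_real_derivative F1 u) (at u)" for u
    unfolding F_def F1_def by (auto intro!: derivative_eq_intros simp: power2_eq_square)
  have dF1: "(F1 has_real_derivative F2 u) (at u)" for u
    unfolding F1_def F2_def
    by (auto intro!: derivative_eq_intros simp: power2_eq_square power3_eq_cube algebra_simps)
  have z: "F (1/2) = 0" "F1 (1/2) = 0" using w by (simp_all add: F_def F1_def)
  have aw: "a * w = w powr (1 - \<beta>) / 4" "a * w * w = w powr (2 - \<beta>) / 4"
    using w powr_mult_base[of w "- \<beta>"] powr_mult_base[of w "1 - \<beta>"]
    by (simp_all add: a_def mult_ac)
  have b: "\<bar>sin x ^ i * cos x ^ j\<bar> \<le> 1" for x :: real and i j :: nat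
    by (simp add: abs_mult power_abs mult_le_one power_le_one)
  have "(wiggle \<beta> w has_real_derivative D u) (at u)" if "0 < u" for u
  proof (rule has_field_derivative_transform_within_open)
    show "((\<lambda>u. if u < 1/2 then F u else 0) has_real_derivative D u) (at u)"
      unfolding D_def
      by (rule has_real_derivative_cutoff[OF dF z])
  qed (use that in \<open>auto intro: open_greaterThan[of 0] simp: wiggle_def F_def a_def\<close>)
  moreover have "\<bar>wiggle \<beta> w u\<bar> \<le> 3 * w powr (- \<beta>)" for u
    using mult_left_mono[OF b[of "w*u" 3 0], of "w powr (-\<beta>)"] powr_ge_zero[of w "-\<beta>"]
    by (auto simp: wiggle_def abs_mult simp del: powr_ge_zero)
  moreover have "\<bar>D u\<bar> \<le> 3 * w powr (1 - \<beta>)" if "0 < u" for u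
  proof -
    have "\<bar>D u\<bar> \<le> 3 / 4 * (w powr (1 - \<beta>) * \<bar>sin (w * u) ^ 2 * cos (w * u) ^ 1\<bar>)"
      by (simp add: D_def F1_def aw abs_mult)
    also have "\<dots> \<le> 3 / 4 * (w powr (1 - \<beta>) * 1)" by (intro mult_left_mono b) auto
    also have "\<dots> \<le> 3 * w powr (1 - \<beta>)" by simp
    finally show ?thesis .
  qed
  moreover have "\<bar>D u - D v\<bar> \<le> 3 * w powr (2 - \<beta>) * \<bar>u - v\<bar>" if "0 < u" "0 < v" for u v
  proof -
    have "\<bar>F2 u\<bar> \<le> 3 * w powr (2 - \<beta>)" for u
    proof -
      have "\<bar>6 * sin (w * u) * cos (w * u) ^ 2 - 3 * sin (w * u) ^ 3\<bar> \<le> 12"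
        using b[of "w*u" 1 2] b[of "w*u" 3 0] by simp
      from mult_left_mono[OF this, of "w powr (2-\<beta>) / 4"] show ?thesis
        by (simp add: F2_def aw(2) abs_mult)
    qed
    then show ?thesis unfolding D_def
      by (rule cutoff_lipschitz[OF dF1 z(2)]) (use that in auto)
  qed
  ultimately have "holder_bounds \<beta> (2 * 3) (wiggle \<beta> w) D"
    by (intro holder_bounds_of_frequency[where w = w] assms) auto
  then show ?thesis by auto
qed

lemma abs_wiggle_le:
  assumes "0 \<le> \<beta>" "1 \<le> w" shows "\<bar>wiggle \<beta> w x\<bar> \<le> base_density x / 2"
proof (cases "0 \<le> x \<and> x < 1/2")
  case True
  have "\<bar>sin (w * x)\<bar> ^ 3 \<le> 1" by (simp add: power_le_one)
  moreover have "w powr (- \<beta>) \<le> 1" using powr_mono[of "-\<beta>" 0 w] assms by simp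
  ultimately have "w powr (- \<beta>) * \<bar>sin (w * x)\<bar> ^ 3 \<le> 1" by (intro mult_le_one) auto
  then have "\<bar>wiggle \<beta> w x\<bar> \<le> 1/4" using True by (simp add: wiggle_def abs_mult power_abs)
  then show ?thesis using base_density_ge[of x] True by simp
qed (auto simp: wiggle_def base_density_nonneg)

lemma has_bochner_integral_base_density: "has_bochner_integral lborel base_density 1"
proof -
  have "has_bochner_integral lborel (\<lambda>x::real. (4 * (1 - x) ^ 3) * indicator {0..1} x) (- ((1 - 1) ^ 4) - (- ((1 - 0) ^ 4)))"
    by (rule has_bochner_integral_FTC_Icc_real)
      (auto intro!: derivative_eq_intros continuous_intros)
  moreover have "(\<lambda>x. (4 * (1 - x) ^ 3) * indicator {0..1} x) = base_density"
    by (auto simp: base_density_def fun_eq_iff indicator_def)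
  ultimately show ?thesis by simp
qed

text \<open>
  Used with \<open>w = 4 \<pi> k\<close>: the primitive takes the same value at \<open>0\<close> and at \<open>1/2\<close>, so the wiggle has
  integral \<open>0\<close> and the primitive of the wiggle stays of order \<open>1 / w\<close> times its amplitude.
\<close>

lemma DERIV_sin_cubed_primitive:
  fixes w x :: real
  assumes "w \<noteq> 0"
  shows "((\<lambda>x. (cos (w * x) ^ 3 / 3 - cos (w * x)) / w) has_real_derivative sin (w * x) ^ 3) (at x)"
proof -
  have s3: "sin (w * x) ^ 3 = sin (w * x) * (1 - cos (w * x) ^ 2)"
    unfolding sin_squared_eq[symmetric] by (simp add: power3_eq_cube power2_eq_square)
  have "((\<lambda>x. cos (w * x) ^ 3 / 3 - cos (w * x)) has_real_derivative w * sin (w * x) ^ 3) (at x)"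
    unfolding s3 by (auto intro!: derivative_eq_intros simp: right_diff_distrib)
  from DERIV_cdivide[OF this, of w] show ?thesis using assms by simp
qed

lemma has_bochner_integral_wiggle:
  assumes "w = 4 * pi * real k" "0 < k"
  shows "has_bochner_integral lborel (wiggle \<beta> w) 0"
proof -
  define F where "F x = w powr (- \<beta>) / 4 * ((cos (w * x) ^ 3 / 3 - cos (w * x)) / w)" for x
  have w: "w > 0" using assms by simp
  have w2: "w * (1/2) = 2 * pi * real k" "w / 2 = 2 * pi * real k" using assms by simp_all
  have sc: "sin (2 * pi * real k) = 0" "cos (2 * pi * real k) = 1"
    using sin_periodic_pi sin_npi2[of "2 * k"] cos_2npi[of k]
    by (simp_all add: mult_ac)
  have "has_bochner_integral lborel (\<lambda>x. (w powr (- \<beta>) / 4 * sin (w * x) ^ 3) * indicator {0..1/2} x) (F (1/2) - F 0)"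
  proof (rule has_bochner_integral_FTC_Icc_real)
    fix x
    show "(F has_real_derivative w powr (- \<beta>) / 4 * sin (w * x) ^ 3) (at x)"
      unfolding F_def using w by (intro DERIV_cmult DERIV_sin_cubed_primitive) simp
  qed (auto intro!: continuous_intros)
  moreover have "(\<lambda>x. (w powr (- \<beta>) / 4 * sin (w * x) ^ 3) * indicator {0..1/2} x) = wiggle \<beta> w"
  proof
    fix x :: real
    show "(w powr (- \<beta>) / 4 * sin (w * x) ^ 3) * indicator {0..1/2} x = wiggle \<beta> w x"
    proof (cases "x = 1/2")
      case True
      have "sin (w * (1/2)) = 0" unfolding w2 by (rule sc)
      then show ?thesis unfolding True by (simp add: wiggle_def)
    qed (auto simp: wiggle_def indicator_def)
  qed
  moreover have "F (1/2) - F 0 = 0" by (simp add: F_def w2 sc)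
  ultimately show ?thesis by simp
qed

lemma prob_density_base_density: "prob_density base_density"
  using has_bochner_integral_base_density base_density_nonneg
  by (auto simp: prob_density_def has_bochner_integral_iff nn_integral_eq_integral)

lemma base_density_in_holder_class:
  assumes "0 < \<beta>" "\<beta> \<le> 2" shows "base_density \<in> holder_class \<beta> 54"
proof -
  obtain D where "holder_bounds \<beta> 48 base_density D" using holder_bounds_base_density[OF assms] by auto
  then have "holder_bounds \<beta> 54 base_density D" by (rule holder_bounds_mono) simp
  then show ?thesis
    by (intro holder_class_memI[OF assms]) (auto simp: prob_density_base_density base_density_def)
qed

definition perturbed_density :: "real \<Rightarrow> real \<Rightarrow> real \<Rightarrow> real" where
  "perturbed_density \<beta> w x = base_density x + wiggle \<beta> w x"

lemma frequency_facts:
  assumes "w = 4 * pi * real k" "0 < k"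
  shows "1 \<le> w" "sin (w / 2) = 0"
proof -
  have "1 * 1 \<le> pi * real k" using pi_gt3 assms by (intro mult_mono) auto
  then show "1 \<le> w" using assms by simp
  show "sin (w / 2) = 0" using assms sin_npi[of "2 * k"] by (simp add: mult_ac)
qed

lemma perturbed_density_ge:
  assumes "0 \<le> \<beta>" "1 \<le> w" shows "base_density x / 2 \<le> perturbed_density \<beta> w x"
  using abs_wiggle_le[OF assms, of x] by (auto simp: perturbed_density_def)

lemma prob_density_perturbed_density:
  assumes "0 \<le> \<beta>" "w = 4 * pi * real k" "0 < k" shows "prob_density (perturbed_density \<beta> w)"
proof -
  have "has_bochner_integral lborel (perturbed_density \<beta> w) (1 + 0)"
    unfolding perturbed_density_def
    by (intro has_bochner_integral_add has_bochner_integral_base_density has_bochner_integral_wiggle[OF assms(2,3)])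
  moreover have "0 \<le> perturbed_density \<beta> w x" for x
    using perturbed_density_ge[OF assms(1) frequency_facts(1)[OF assms(2,3)], of x] base_density_nonneg[of x] by simp
  ultimately show ?thesis
    by (auto simp: prob_density_def has_bochner_integral_iff nn_integral_eq_integral)
qed

lemma perturbed_density_in_holder_class:
  assumes "0 < \<beta>" "\<beta> \<le> 2" "w = 4 * pi * real k" "0 < k"
  shows "perturbed_density \<beta> w \<in> holder_class \<beta> 54"
proof -
  obtain D where D: "holder_bounds \<beta> 48 base_density D" using holder_bounds_base_density[OF assms(1,2)] by auto
  obtain E where E: "holder_bounds \<beta> 6 (wiggle \<beta> w) E"
    using holder_bounds_wiggle[OF assms(1,2) frequency_facts[OF assms(3,4)]] by auto
  have "holder_bounds \<beta> 54 (perturbed_density \<beta> w) (\<lambda>u. D u + E u)"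
    using holder_bounds_add[OF D E] by (simp add: perturbed_density_def[abs_def])
  then show ?thesis using assms prob_density_perturbed_density[of \<beta> w k]
    by (intro holder_class_memI) (auto simp: perturbed_density_def base_density_def wiggle_def)
qed

section \<open>Separation of the two densities\<close>

text \<open>
  Tangent lines replace Jensen's inequality below: the lower bounds they give are integrable
  even where nothing is known about the integrability of the power.
\<close>

lemma powr_above_tangent:
  fixes a y p :: real
  assumes "0 < a" "0 \<le> y" "1 \<le> p"
  shows "a powr p + p * a powr (p - 1) * (y - a) \<le> y powr p"
proof (cases "y = 0")
  case True
  have "a powr p = a * a powr (p - 1)" using powr_mult_base[of a "p - 1"] assms by simp
  then have "a powr p + p * a powr (p - 1) * (y - a) = (1 - p) * (a * a powr (p - 1))"
    using True by (simp add: algebra_simps)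
  also have "\<dots> \<le> 0" using assms by (intro mult_nonpos_nonneg) auto
  finally show ?thesis using True by simp
next
  case False
  have "y powr p - a powr p \<ge> p * a powr (p - 1) * (y - a)"
  proof (rule convex_on_imp_above_tangent)
    show "convex_on {0<..} (\<lambda>x. x powr p)" by (rule powr_convex) fact
    show "((\<lambda>x. x powr p) has_real_derivative p * a powr (p - 1)) (at a within {0<..})"
      using \<open>0 < a\<close> by (auto intro!: derivative_eq_intros)
    show "a \<in> interior {0<..}" using \<open>0 < a\<close> by (simp add: interior_open)
  qed (use assms False in auto)
  then show ?thesis by simp
qed

lemma ennreal_integral_le:
  assumes "integrable M h" shows "ennreal (integral\<^sup>L M h) \<le> (\<integral>\<^sup>+x. ennreal (h x) \<partial>M)"
proof -
  have "integral\<^sup>L M h \<le> (\<integral>x. max 0 (h x) \<partial>M)" using assms by (intro integral_mono) auto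
  then have "ennreal (integral\<^sup>L M h) \<le> ennreal (\<integral>x. max 0 (h x) \<partial>M)" by (rule ennreal_leI)
  also have "\<dots> = (\<integral>\<^sup>+x. ennreal (max 0 (h x)) \<partial>M)"
    using assms by (intro nn_integral_eq_integral[symmetric]) auto
  finally show ?thesis by (simp add: ennreal_max_0)
qed

lemma has_bochner_integral_sin4:
  assumes "w = 4 * pi * real k" "0 < k"
  shows "has_bochner_integral lborel (\<lambda>x. sin (w * x) ^ 4 * indicator {1/4..1/2} x) (3 / 32)"
proof -
  have w: "w > 0" using assms by simp
  define F where "F x = 3 / 8 * x - sin (2 * (w * x)) / (4 * w) + sin (4 * (w * x)) / (32 * w)" for x
  have *: "(F has_real_derivative (3 / 8 - cos (2 * (w * x)) / 2 + cos (4 * (w * x)) / 8)) (at x)" for x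
  proof -
    have "((\<lambda>x. sin (c * x)) has_real_derivative cos (c * x) * c) (at x)" for c :: real
      by (auto intro!: derivative_eq_intros)
    from DERIV_cdivide[OF this[of "2 * w"], of "4 * w"] DERIV_cdivide[OF this[of "4 * w"], of "32 * w"]
    have "((\<lambda>x. sin (2 * (w * x)) / (4 * w)) has_real_derivative cos (2 * (w * x)) / 2) (at x)"
      "((\<lambda>x. sin (4 * (w * x)) / (32 * w)) has_real_derivative cos (4 * (w * x)) / 8) (at x)"
      using w by (simp_all add: mult.assoc)
    from DERIV_add[OF DERIV_diff[OF DERIV_cmult[OF DERIV_ident, of "3/8"] this(1)] this(2)]
    show ?thesis by (simp add: F_def[abs_def])
  qed
  have p4: "3 / 8 - cos (2 * y) / 2 + cos (4 * y) / 8 = sin y ^ 4" for y :: real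
  proof -
    have c2: "cos (2 * y) = 1 - 2 * sin y ^ 2" by (rule cos_double_sin)
    have "cos (4 * y) = 2 * cos (2 * y) ^ 2 - 1" using cos_double_cos[of "2 * y"] by simp
    then have c4: "cos (4 * y) = 2 * (1 - 2 * sin y ^ 2) ^ 2 - 1" unfolding c2 .
    show ?thesis unfolding c2 c4 by (simp add: field_simps power2_eq_square power4_eq_xxxx)
  qed
  have "has_bochner_integral lborel (\<lambda>x. sin (w * x) ^ 4 * indicator {1/4..1/2} x) (F (1/2) - F (1/4))"
    using *[unfolded p4] by (intro has_bochner_integral_FTC_Icc_real) (auto intro!: continuous_intros)
  moreover have "F (1/2) - F (1/4) = 3 / 32"
  proof -
    have s: "sin (real (m * k) * pi) = 0" for m by (rule sin_npi)
    have "2 * (w * (1/2)) = real (4 * k) * pi" "4 * (w * (1/2)) = real (8 * k) * pi"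
      "2 * (w * (1/4)) = real (2 * k) * pi" "4 * (w * (1/4)) = real (4 * k) * pi"
      using assms by simp_all
    then show ?thesis unfolding F_def by (simp only: s)
  qed
  ultimately show ?thesis by simp
qed

text \<open>
  The cube of the absolute sine is bounded below by the fourth power, whose mean over \<open>[1/4,1/2]\<close> is \<open>3/8\<close>.
  After subtraction of \<open>1/4\<close> a mean of at least \<open>1/8\<close> is left, and by convexity the \<open>p\<close>-th
  power has a mean of at least \<open>(1/8) powr p\<close>. The margin \<open>1/4\<close> leaves room for
  what the estimator recovers of the oscillation.
\<close>

lemma max_risk_ge_of_sine_separation:
  assumes T: "T \<in> estimators n" and p: "1 \<le> p" and \<beta>: "0 < \<beta>" "\<beta> \<le> 2"
    and w: "w = 4 * pi * real k" "0 < k" and "0 \<le> \<kappa>"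
    and sep: "\<And>x. 1/4 \<le> x \<Longrightarrow> x \<le> 1/2 \<Longrightarrow>
      ennreal (\<kappa> powr p * max 0 (\<bar>sin (w * x)\<bar> ^ 3 - 1/4) powr p)
      \<le> pointwise_risk p n T base_density x + pointwise_risk p n T (perturbed_density \<beta> w) x"
  shows "ennreal (\<kappa> / 64) \<le> max_risk p n T (holder_class \<beta> 54)"
proof -
  define A where "A = (1/8 :: real) powr p"
  define B where "B = p * (1/8 :: real) powr (p - 1)"
  \<comment> \<open>the tangent of the power at \<open>1/8\<close>, applied to \<open>sin\<^sup>4 - 1/4\<close>\<close>
  define h where "h x = \<kappa> powr p * ((A + B * (sin (w * x) ^ 4 - 3/8)) * indicator {1/4..1/2} x)" for x
  have "has_bochner_integral lborel h (\<kappa> powr p * ((A - B * 3 / 8) * (1/4) + B * (3 / 32)))"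
  proof -
    have "has_bochner_integral lborel (\<lambda>x::real. (A - B * 3/8) * indicator {1/4..1/2} x) ((A - B * 3/8) * (1/4 :: real))"
      by (intro has_bochner_integral_mult_right) (auto simp: has_bochner_integral_iff)
    from has_bochner_integral_mult_right[OF has_bochner_integral_add[OF this
        has_bochner_integral_mult_right[OF has_bochner_integral_sin4[OF w], of B]], of "\<kappa> powr p"]
    show ?thesis by (simp add: h_def[abs_def] algebra_simps)
  qed
  then have h: "integrable lborel h" "integral\<^sup>L lborel h = \<kappa> powr p * A / 4"
    by (simp_all add: has_bochner_integral_iff algebra_simps)
  have le: "h x \<le> \<kappa> powr p * max 0 (\<bar>sin (w * x)\<bar> ^ 3 - 1/4) powr p" if "1/4 \<le> x" "x \<le> 1/2" for x
  proof -
    define y where "y = max 0 (\<bar>sin (w * x)\<bar> ^ 3 - 1/4)"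
    have "sin (w * x) ^ 4 = \<bar>sin (w * x)\<bar> ^ 4" by simp
    also have "\<dots> \<le> \<bar>sin (w * x)\<bar> ^ 3" by (rule power_decreasing) auto
    finally have "sin (w * x) ^ 4 - 3/8 \<le> y - 1/8" by (simp add: y_def)
    then have "A + B * (sin (w * x) ^ 4 - 3/8) \<le> A + B * (y - 1/8)"
      using p by (simp add: B_def)
    also have "\<dots> \<le> y powr p"
      using powr_above_tangent[of "1/8" y p] p by (simp add: A_def B_def y_def)
    finally show ?thesis using that by (simp add: h_def y_def mult_left_mono)
  qed
  have "2 * (\<kappa> / 64) powr p \<le> \<kappa> powr p * A / 4"
  proof -
    have "(1/8::real) powr p \<le> (1/8) powr 1" using p by (intro powr_mono') auto
    then have "2 * A * A \<le> 2 * (1/8) * A" unfolding A_def by (intro mult_right_mono) auto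
    moreover have "(\<kappa> / 64) powr p = \<kappa> powr p * (A * A)"
      using \<open>0 \<le> \<kappa>\<close> by (simp add: A_def powr_divide powr_mult[symmetric])
    ultimately show ?thesis using mult_left_mono[of "2 * A * A" "A / 4" "\<kappa> powr p"] by (simp add: mult_ac)
  qed
  then have "ennreal (2 * (\<kappa> / 64) powr p) \<le> ennreal (integral\<^sup>L lborel h)"
    unfolding h(2) by (rule ennreal_leI)
  also have "\<dots> \<le> (\<integral>\<^sup>+x. ennreal (h x) \<partial>lborel)" by (rule ennreal_integral_le) fact
  also have "\<dots> \<le> (\<integral>\<^sup>+x\<in>{0..}. (pointwise_risk p n T base_density x
      + pointwise_risk p n T (perturbed_density \<beta> w) x) \<partial>lborel)"
  proof (rule nn_integral_mono)
    fix x :: real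
    show "ennreal (h x) \<le> (pointwise_risk p n T base_density x
      + pointwise_risk p n T (perturbed_density \<beta> w) x) * indicator {0..} x"
    proof (cases "1/4 \<le> x \<and> x \<le> 1/2")
      case True
      then show ?thesis using order_trans[OF ennreal_leI[OF le[of x]] sep[of x]] by simp
    qed (simp add: h_def)
  qed
  finally show ?thesis
    using p \<beta> w \<open>0 \<le> \<kappa>\<close>
    by (intro max_risk_lower_bound_pair[OF T base_density_in_holder_class prob_density_base_density
      perturbed_density_in_holder_class prob_density_perturbed_density]) auto
qed

text \<open>
  A lower bound for one density in terms of another carries over to the laws of samples, one
  coordinate at a time.
\<close>

lemma PiM_density_minorize:
  fixes f g :: "real \<Rightarrow> real"
  assumes f: "prob_density f" and g: "prob_density g" and c: "0 \<le> c" "\<And>x. c * g x \<le> f x"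
    and "finite I" and F: "F \<in> borel_measurable (\<Pi>\<^sub>M i\<in>I. borel)"
  shows "ennreal (c ^ card I) * (\<integral>\<^sup>+X. F X \<partial>(\<Pi>\<^sub>M i\<in>I. density lborel (\<lambda>x. ennreal (g x))))
    \<le> (\<integral>\<^sup>+X. F X \<partial>(\<Pi>\<^sub>M i\<in>I. density lborel (\<lambda>x. ennreal (f x))))"
  using \<open>finite I\<close> F
proof (induction I arbitrary: F)
  case empty
  then show ?case by (simp add: PiM_empty)
next
  case (insert i I)
  define Mf where "Mf = density lborel (\<lambda>x. ennreal (f x))"
  define Mg where "Mg = density lborel (\<lambda>x. ennreal (g x))"
  interpret f: product_prob_space "\<lambda>_. Mf" unfolding Mf_def by (rule product_prob_space_density[OF f])
  interpret g: product_prob_space "\<lambda>_. Mg" unfolding Mg_def by (rule product_prob_space_density[OF g])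
  have fm [measurable]: "f \<in> borel_measurable borel" "g \<in> borel_measurable borel"
    using f g by (auto simp: prob_density_def)
  have s [measurable_cong]: "sets Mf = sets borel" "sets Mg = sets borel" by (auto simp: Mf_def Mg_def)
  note insert.prems [measurable]
  have F1: "F \<in> borel_measurable (\<Pi>\<^sub>M i\<in>insert i I. Mf)" "F \<in> borel_measurable (\<Pi>\<^sub>M i\<in>insert i I. Mg)"
    by measurable
  have "(\<lambda>(X, y). F (X(i := y))) \<in> borel_measurable ((\<Pi>\<^sub>M i\<in>I. borel) \<Otimes>\<^sub>M borel)" by measurable
  then have m: "(\<lambda>(X, y). F (X(i := y))) \<in> borel_measurable ((\<Pi>\<^sub>M i\<in>I. borel) \<Otimes>\<^sub>M Mf)"
    by (simp cong: measurable_cong_sets sets_pair_measure_cong add: s)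
  have inner: "ennreal c * (\<integral>\<^sup>+y. F (X(i := y)) \<partial>Mg) \<le> (\<integral>\<^sup>+y. F (X(i := y)) \<partial>Mf)"
    if X: "X \<in> space (\<Pi>\<^sub>M i\<in>I. borel)" for X :: "_ \<Rightarrow> real"
  proof -
    have [measurable]: "(\<lambda>y. F (X(i := y))) \<in> borel_measurable borel"
      using measurable_compose[OF measurable_component_update[OF X] insert.prems] insert.hyps by (simp add: fun_upd_def)
    have "ennreal c * (\<integral>\<^sup>+y. F (X(i := y)) \<partial>Mg) = (\<integral>\<^sup>+y. ennreal (c * g y) * F (X(i := y)) \<partial>lborel)"
      using c by (simp add: Mg_def nn_integral_density nn_integral_cmult[symmetric] ennreal_mult' mult.assoc)
    also have "\<dots> \<le> (\<integral>\<^sup>+y. ennreal (f y) * F (X(i := y)) \<partial>lborel)"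
      using c(2) by (intro nn_integral_mono mult_right_mono ennreal_leI) auto
    also have "\<dots> = (\<integral>\<^sup>+y. F (X(i := y)) \<partial>Mf)" by (simp add: Mf_def nn_integral_density)
    finally show ?thesis .
  qed
  have "ennreal (c ^ card (insert i I)) * (\<integral>\<^sup>+X. F X \<partial>(\<Pi>\<^sub>M i\<in>insert i I. Mg))
      = ennreal (c ^ card I) * (ennreal c * (\<integral>\<^sup>+X. (\<integral>\<^sup>+y. F (X(i := y)) \<partial>Mg) \<partial>(\<Pi>\<^sub>M i\<in>I. Mg)))"
    using insert.hyps c F1
    by (simp add: g.product_nn_integral_insert ennreal_mult' mult_ac)
  also have "\<dots> = ennreal (c ^ card I) * (\<integral>\<^sup>+X. ennreal c * (\<integral>\<^sup>+y. F (X(i := y)) \<partial>Mg) \<partial>(\<Pi>\<^sub>M i\<in>I. Mg))"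
    by (subst nn_integral_cmult) auto
  also have "\<dots> \<le> ennreal (c ^ card I) * (\<integral>\<^sup>+X. (\<integral>\<^sup>+y. F (X(i := y)) \<partial>Mf) \<partial>(\<Pi>\<^sub>M i\<in>I. Mg))"
    by (intro mult_left_mono nn_integral_mono inner) (auto simp: space_PiM s[THEN sets_eq_imp_space_eq])
  also have "\<dots> \<le> (\<integral>\<^sup>+X. (\<integral>\<^sup>+y. F (X(i := y)) \<partial>Mf) \<partial>(\<Pi>\<^sub>M i\<in>I. Mf))"
    unfolding Mf_def[symmetric] Mg_def[symmetric]
    using insert.IH[OF f.M.borel_measurable_nn_integral[OF m]] by (simp add: Mf_def Mg_def fun_upd_def)
  also have "\<dots> = (\<integral>\<^sup>+X. F X \<partial>(\<Pi>\<^sub>M i\<in>insert i I. Mf))"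
    using insert.hyps F1 by (simp add: f.product_nn_integral_insert)
  finally show ?case by (simp add: Mf_def Mg_def)
qed

lemma half_diff_powr_le:
  fixes a b p :: real
  assumes "0 \<le> p"
  shows "(\<bar>a - b\<bar> / 2) powr p \<le> \<bar>a\<bar> powr p + \<bar>b\<bar> powr p"
proof -
  have "\<bar>a - b\<bar> / 2 \<le> \<bar>a\<bar> \<or> \<bar>a - b\<bar> / 2 \<le> \<bar>b\<bar>"
    using abs_triangle_ineq4[of a b] by auto
  then show ?thesis
  proof
    assume "\<bar>a - b\<bar> / 2 \<le> \<bar>a\<bar>"
    then have "(\<bar>a - b\<bar> / 2) powr p \<le> \<bar>a\<bar> powr p" using assms by (intro powr_mono2) auto
    then show ?thesis by (simp add: add_increasing2)
  next
    assume "\<bar>a - b\<bar> / 2 \<le> \<bar>b\<bar>"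
    then have "(\<bar>a - b\<bar> / 2) powr p \<le> \<bar>b\<bar> powr p" using assms by (intro powr_mono2) auto
    then show ?thesis by (simp add: add_increasing)
  qed
qed

text \<open>
  The perturbed density is at least half the base density, so an expectation under the former is
  at least \<open>1/2^n\<close> times the expectation under the latter. Under a common law no
  estimator is close to both densities.
\<close>

lemma minimax_risk_pos:
  assumes p: "1 \<le> p" and \<beta>: "0 < \<beta>" "\<beta> \<le> 2"
  shows "0 < minimax_risk p n (holder_class \<beta> 54)"
proof -
  define w where "w = 4 * pi * real 1"
  have w: "w = 4 * pi * real 1" "0 < (1::nat)" by (auto simp: w_def)
  have w1: "1 \<le> w" by (rule frequency_facts[OF w])
  define f where "f = perturbed_density \<beta> w"
  have fb: "prob_density f" "prob_density base_density"
    unfolding f_def using prob_density_perturbed_density[OF _ w] \<beta> prob_density_base_density by auto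
  have [measurable]: "f \<in> borel_measurable borel" using fb by (simp add: prob_density_def)
  define q where "q = w powr (- \<beta>) / 8"
  have q: "0 < q" using w1 by (simp add: q_def)
  define \<kappa> where "\<kappa> = ((1/2) ^ n) powr (1 / p) * q"
  have \<kappa>: "0 < \<kappa>" using q by (simp add: \<kappa>_def)
  have "ennreal (\<kappa> / 64) \<le> max_risk p n T (holder_class \<beta> 54)" if T: "T \<in> estimators n" for T
  proof (rule max_risk_ge_of_sine_separation[OF T p \<beta> w])
    fix x :: real assume x: "1/4 \<le> x" "x \<le> 1/2"
    interpret B: prob_space "iid_law n base_density" by (rule prob_space_iid_law) (rule fb)
    have "(\<lambda>X. T X x) \<in> borel_measurable (\<Pi>\<^sub>M i\<in>{1..n}. borel)"
      using measurable_compose[OF measurable_Pair2' T[unfolded estimators_def mem_Collect_eq], of x]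
      by simp
    then have mT: "(\<lambda>X. ennreal (\<bar>T X x - f x\<bar> powr p)) \<in> borel_measurable (\<Pi>\<^sub>M i\<in>{1..n}. borel)"
      and mT1: "(\<lambda>X. T X x) \<in> borel_measurable (iid_law n base_density)"
      by (simp_all cong: measurable_cong_sets add: sets_iid_law)
    define c where "c = (1/2 :: real) ^ n"
    have c: "0 < c" "c \<le> 1" by (auto simp: c_def power_le_one)
    have *: "ennreal c * (\<integral>\<^sup>+X. ennreal (\<bar>T X x - f x\<bar> powr p) \<partial>iid_law n base_density)
        \<le> pointwise_risk p n T f x"
      unfolding pointwise_risk_def iid_law_def c_def
      using PiM_density_minorize[OF fb, of "1/2" "{1..n}", OF _ _ _ mT] perturbed_density_ge[OF _ w1, of \<beta>] \<beta>
      by (simp add: f_def)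
    have "\<kappa> powr p * max 0 (\<bar>sin (w * x)\<bar> ^ 3 - 1/4) powr p
        \<le> \<kappa> powr p * (\<bar>sin (w * x)\<bar> ^ 3) powr p"
      using p by (intro mult_left_mono powr_mono2) auto
    also have "\<dots> \<le> c * (\<bar>base_density x - f x\<bar> / 2) powr p"
    proof (cases "x = 1/2")
      case True
      have "sin (w * (1/2)) = 0" using frequency_facts(2)[OF w] by simp
      then show ?thesis unfolding True using c by simp
    next
      case False
      then have "\<bar>base_density x - f x\<bar> / 2 = q * \<bar>sin (w * x)\<bar> ^ 3"
        using x by (simp add: q_def f_def perturbed_density_def wiggle_def abs_mult power_abs)
      moreover have "\<kappa> powr p = c * q powr p"
        using c p q by (simp add: \<kappa>_def powr_mult powr_powr c_def)
      ultimately show ?thesis using q by (simp add: powr_mult)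
    qed
    finally have "ennreal (\<kappa> powr p * max 0 (\<bar>sin (w * x)\<bar> ^ 3 - 1/4) powr p)
       \<le> (\<integral>\<^sup>+X. ennreal (c * (\<bar>base_density x - f x\<bar> / 2) powr p) \<partial>iid_law n base_density)"
      by (simp add: B.emeasure_space_1 ennreal_leI)
    also have "\<dots> \<le> (\<integral>\<^sup>+X. ennreal (\<bar>T X x - base_density x\<bar> powr p)
        + ennreal c * ennreal (\<bar>T X x - f x\<bar> powr p) \<partial>iid_law n base_density)"
    proof (rule nn_integral_mono)
      fix X
      have "c * (\<bar>base_density x - f x\<bar> / 2) powr p
        \<le> c * (\<bar>T X x - f x\<bar> powr p + \<bar>T X x - base_density x\<bar> powr p)"
        using half_diff_powr_le[of p "T X x - f x" "T X x - base_density x"] p c by simp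
      also have "\<dots> \<le> \<bar>T X x - base_density x\<bar> powr p + c * \<bar>T X x - f x\<bar> powr p"
        using mult_right_mono[OF c(2), of "\<bar>T X x - base_density x\<bar> powr p"] by (simp add: distrib_left)
      finally show "ennreal (c * (\<bar>base_density x - f x\<bar> / 2) powr p)
        \<le> ennreal (\<bar>T X x - base_density x\<bar> powr p) + ennreal c * ennreal (\<bar>T X x - f x\<bar> powr p)"
        using c by (simp add: ennreal_plus[symmetric] ennreal_mult[symmetric] ennreal_leI del: ennreal_plus)
    qed
    also have "\<dots> = pointwise_risk p n T base_density x
        + ennreal c * (\<integral>\<^sup>+X. ennreal (\<bar>T X x - f x\<bar> powr p) \<partial>iid_law n base_density)"
      using mT1 by (simp add: nn_integral_add nn_integral_cmult pointwise_risk_def)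
    also have "\<dots> \<le> pointwise_risk p n T base_density x + pointwise_risk p n T f x"
      by (intro add_left_mono *)
    finally show "ennreal (\<kappa> powr p * max 0 (\<bar>sin (w * x)\<bar> ^ 3 - 1/4) powr p)
      \<le> pointwise_risk p n T base_density x + pointwise_risk p n T (perturbed_density \<beta> w) x"
      by (simp add: f_def)
  qed (use \<kappa> in auto)
  then have "ennreal (\<kappa> / 64) \<le> minimax_risk p n (holder_class \<beta> 54)"
    unfolding minimax_risk_def by (rule INF_greatest)
  then show ?thesis using \<kappa> by (intro less_le_trans[OF _ \<open>ennreal (\<kappa> / 64) \<le> _\<close>]) simp
qed

section \<open>The minimax upper bound\<close>

lemma holder_class_D:
  assumes "f \<in> holder_class \<beta> L"
  shows "prob_density f" "\<And>x. x \<notin> {0..1} \<Longrightarrow> f x = 0" "\<And>u. 0 < u \<Longrightarrow> \<bar>f u\<bar> \<le> L"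
  using assms by (auto simp: holder_class_def Let_def)

text \<open>
  The slope is \<open>0\<close> for \<open>\<beta> \<le> 1\<close> and the derivative at \<open>x\<close> otherwise.
\<close>

lemma holder_class_taylor:
  assumes f: "f \<in> holder_class \<beta> L" and \<beta>: "0 < \<beta>" "\<beta> \<le> 2" and x: "0 < x" and "0 \<le> L"
  obtains d where "\<And>s. 0 \<le> s \<Longrightarrow> \<bar>f (x + s) - f x - s * d\<bar> \<le> L * s powr \<beta>"
proof (cases "\<beta> \<le> 1")
  case True
  have H: "\<bar>f u - f v\<bar> / \<bar>u - v\<bar> powr \<beta> \<le> L" if "0 < u" "0 < v" "u \<noteq> v" for u v
    using f that True unfolding holder_class_def holder_order_eq[OF \<beta>] Let_def by auto
  have "\<bar>f (x + s) - f x - s * 0\<bar> \<le> L * s powr \<beta>" if "0 \<le> s" for s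
    using H[of "x + s" x] that x by (cases "s = 0") (auto simp: divide_le_eq)
  then show ?thesis using that by blast
next
  case False
  have H: "\<bar>deriv f u - deriv f v\<bar> / \<bar>u - v\<bar> powr (\<beta> - 1) \<le> L" if "0 < u" "0 < v" "u \<noteq> v" for u v
    using f that False unfolding holder_class_def holder_order_eq[OF \<beta>] Let_def by auto
  have D: "(f has_real_derivative deriv f u) (at u)" if "0 < u" for u
    using f that False unfolding holder_class_def holder_order_eq[OF \<beta>] Let_def
    by (auto simp: field_differentiable_derivI)
  have "\<bar>f (x + s) - f x - s * deriv f x\<bar> \<le> L * s powr \<beta>" if "0 \<le> s" for s
  proof (cases "s = 0")
    case False
    then have s: "0 < s" using that by simp
    obtain z where z: "x < z" "z < x + s" "f (x + s) - f x = (x + s - x) * deriv f z"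
      using MVT2[of x "x + s" f "deriv f"] D s x by auto
    have "\<bar>deriv f z - deriv f x\<bar> \<le> L * \<bar>z - x\<bar> powr (\<beta> - 1)"
      using H[of z x] z x by (simp add: divide_le_eq)
    also have "\<dots> \<le> L * s powr (\<beta> - 1)"
      using z \<open>\<not> \<beta> \<le> 1\<close> \<open>0 \<le> L\<close> by (intro mult_left_mono powr_mono2) auto
    finally have "s * \<bar>deriv f z - deriv f x\<bar> \<le> s * (L * s powr (\<beta> - 1))" using s by simp
    moreover have "f (x + s) - f x - s * deriv f x = s * (deriv f z - deriv f x)"
      using z(3) by (simp add: algebra_simps)
    moreover have "s * (L * s powr (\<beta> - 1)) = L * s powr \<beta>"
      using powr_mult_base[of s "\<beta> - 1"] s by simp
    ultimately show ?thesis using s by (simp add: abs_mult)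
  qed (use \<open>0 \<le> L\<close> in auto)
  then show ?thesis using that by blast
qed

text \<open>
  The linear factor is determined by the conditions that the integral is \<open>1\<close> and the first
  moment is \<open>0\<close>. Because the support is \<open>[0,1]\<close>, the estimator at \<open>x\<close> uses only observations to the right
  of \<open>x\<close>, where the density is smooth even for \<open>x\<close> close to the jump at \<open>0\<close>.
\<close>

definition onesided_kernel :: "real \<Rightarrow> real" where
  "onesided_kernel u = (4 - 6 * u) * indicator {0..1} u"

text \<open>
  All densities in question vanish to the right of \<open>1\<close>, so the estimate \<open>0\<close> is exact there.
\<close>

definition onesided_kde :: "nat \<Rightarrow> real \<Rightarrow> (nat \<Rightarrow> real) \<Rightarrow> real \<Rightarrow> real" where
  "onesided_kde n h X x =
     (if x \<le> 1 then (1 / real n) * (\<Sum>i = 1..n. onesided_kernel ((X i - x) / h) / h) else 0)"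

lemma measurable_onesided_kernel [measurable]: "onesided_kernel \<in> borel_measurable borel"
  unfolding onesided_kernel_def by measurable

lemma onesided_kde_in_estimators: "onesided_kde n h \<in> estimators n"
  unfolding estimators_def onesided_kde_def case_prod_beta mem_Collect_eq by measurable

lemma abs_onesided_kernel_le: "\<bar>onesided_kernel u\<bar> \<le> 4 * indicator {0..1} u"
  by (auto simp: onesided_kernel_def indicator_def)

lemma has_bochner_integral_onesided_kernel:
  "has_bochner_integral lborel onesided_kernel 1"
  "has_bochner_integral lborel (\<lambda>u. u * onesided_kernel u) 0"
proof -
  have "has_bochner_integral lborel (\<lambda>u::real. (4 - 6 * u) * indicator {0..1} u)
      ((4 * 1 - 3 * 1 ^ 2) - (4 * 0 - 3 * 0 ^ 2))"
    by (rule has_bochner_integral_FTC_Icc_real) (auto intro!: derivative_eq_intros continuous_intros)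
  then show "has_bochner_integral lborel onesided_kernel 1"
    by (simp add: onesided_kernel_def[abs_def])
  have "has_bochner_integral lborel (\<lambda>u::real. (u * (4 - 6 * u)) * indicator {0..1} u)
      ((2 * 1 ^ 2 - 2 * 1 ^ 3) - (2 * 0 ^ 2 - 2 * 0 ^ 3))"
    by (rule has_bochner_integral_FTC_Icc_real)
      (auto intro!: derivative_eq_intros continuous_intros simp: algebra_simps power2_eq_square)
  then show "has_bochner_integral lborel (\<lambda>u. u * onesided_kernel u) 0"
    by (simp add: onesided_kernel_def[abs_def] mult.assoc)
qed

lemma integrable_of_bound_on_unit:
  fixes g :: "real \<Rightarrow> real"
  assumes [measurable]: "g \<in> borel_measurable borel" and b: "\<And>u. \<bar>g u\<bar> \<le> B * indicator {0..1} u"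
  shows "integrable lborel g" "\<bar>\<integral>u. g u \<partial>lborel\<bar> \<le> B"
proof -
  have i: "integrable lborel (\<lambda>u::real. B * indicator {0..1} u)" by simp
  show g: "integrable lborel g"
    by (rule Bochner_Integration.integrable_bound[OF i]) (use b in \<open>auto intro: order_trans[OF _ abs_ge_self]\<close>)
  have "\<bar>\<integral>u. g u \<partial>lborel\<bar> \<le> (\<integral>u. \<bar>g u\<bar> \<partial>lborel)" by (rule integral_abs_bound)
  also have "\<dots> \<le> (\<integral>u. B * indicator {0..1::real} u \<partial>lborel)"
    using i g b by (intro integral_mono) auto
  also have "\<dots> = B" by simp
  finally show "\<bar>\<integral>u. g u \<partial>lborel\<bar> \<le> B" .
qed

text \<open>
  Substitution gives an average of \<open>f (x + h u)\<close> with respect to the kernel. The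
  constant term of the Taylor expansion is reproduced, the linear one is annihilated, and the kernel is at most \<open>4\<close>
  in absolute value.
\<close>

lemma onesided_kernel_bias:
  assumes f: "f \<in> holder_class \<beta> L" and \<beta>: "0 < \<beta>" "\<beta> \<le> 2" and L: "0 \<le> L"
    and x: "0 < x" and h: "0 < h"
  shows "\<bar>(\<integral>t. onesided_kernel ((t - x) / h) / h * f t \<partial>lborel) - f x\<bar> \<le> 4 * L * h powr \<beta>"
proof -
  have [measurable]: "f \<in> borel_measurable borel"
    using holder_class_D(1)[OF f] by (simp add: prob_density_def)
  obtain d where d: "\<And>s. 0 \<le> s \<Longrightarrow> \<bar>f (x + s) - f x - s * d\<bar> \<le> L * s powr \<beta>"
    using holder_class_taylor[OF f \<beta> x L] by blast
  define R where "R u = onesided_kernel u * (f (x + h * u) - f x - h * u * d)" for u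
  have Rm: "R \<in> borel_measurable borel" unfolding R_def by measurable
  have Rb: "\<bar>R u\<bar> \<le> (4 * L * h powr \<beta>) * indicator {0..1} u" for u
  proof (cases "u \<in> {0..1}")
    case True
    have "\<bar>f (x + h * u) - f x - h * u * d\<bar> \<le> L * (h * u) powr \<beta>" using True h by (intro d) auto
    also have "\<dots> \<le> L * h powr \<beta>" using True h \<beta> L
      by (intro mult_left_mono powr_mono2) (auto simp: mult_left_le)
    finally have "\<bar>onesided_kernel u\<bar> * \<bar>f (x + h * u) - f x - h * u * d\<bar> \<le> 4 * (L * h powr \<beta>)"
      using abs_onesided_kernel_le[of u] True L by (intro mult_mono) auto
    then show ?thesis using True by (simp add: R_def abs_mult)
  qed (simp add: R_def onesided_kernel_def)
  note R = integrable_of_bound_on_unit[OF Rm Rb]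
  have k: "has_bochner_integral lborel (\<lambda>u. R u + (f x * onesided_kernel u + (h * d) * (u * onesided_kernel u)))
      ((\<integral>u. R u \<partial>lborel) + (f x * 1 + (h * d) * 0))"
    by (intro has_bochner_integral_add has_bochner_integral_mult_right
        has_bochner_integral_onesided_kernel has_bochner_integral_integrable R(1))
  have "(\<integral>t. onesided_kernel ((t - x) / h) / h * f t \<partial>lborel)
      = \<bar>h\<bar> *\<^sub>R (\<integral>u. onesided_kernel (((x + h * u) - x) / h) / h * f (x + h * u) \<partial>lborel)"
    using h by (intro lborel_integral_real_affine) simp
  also have "\<dots> = (\<integral>u. onesided_kernel u * f (x + h * u) \<partial>lborel)"
    using h by simp
  also have "(\<lambda>u. onesided_kernel u * f (x + h * u))
      = (\<lambda>u. R u + (f x * onesided_kernel u + (h * d) * (u * onesided_kernel u)))"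
    by (simp add: R_def algebra_simps fun_eq_iff)
  also have "integral\<^sup>L lborel \<dots> = (\<integral>u. R u \<partial>lborel) + f x"
    using has_bochner_integral_integral_eq[OF k] by simp
  finally show ?thesis using R(2) by simp
qed

lemma powr_le_exp: "y powr p \<le> p powr p * exp y" if "0 \<le> y" "0 < p" for y p :: real
proof (cases "y = 0")
  case False
  then have y: "0 < y" using that by simp
  have "y powr p = p powr p * (y / p) powr p" using that by (simp add: powr_mult[symmetric])
  also have "(y / p) powr p = exp (p * ln (y / p))" using y that by (simp add: powr_def)
  also have "\<dots> \<le> exp y"
  proof -
    have "p * ln (y / p) \<le> p * (y / p)"
      using ln_le_minus_one[of "y / p"] y that by (intro mult_left_mono) auto
    then show ?thesis using that by simp
  qed
  finally show ?thesis by (simp add: mult_left_mono)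
qed (use that in auto)

lemma exp_le_quadratic: "exp v \<le> 1 + v + v\<^sup>2 * exp B" if "\<bar>v\<bar> \<le> B" for v B :: real
proof -
  obtain t where t: "\<bar>t\<bar> \<le> \<bar>v\<bar>" "exp v = (\<Sum>m<2. v ^ m / fact m) + exp t / fact 2 * v ^ 2"
    using Maclaurin_exp_le[of v 2] by auto
  have "exp t / 2 * v\<^sup>2 \<le> exp B * v\<^sup>2"
  proof (intro mult_right_mono)
    have "exp t \<le> exp B" using t(1) that by simp
    then show "exp t / 2 \<le> exp B" using exp_gt_zero[of t] by linarith
  qed simp
  then show ?thesis using t(2) by (simp add: numeral_2_eq_2 mult.commute)
qed

lemma nn_integral_iid_law_prod:
  assumes f: "prob_density f" and [measurable]: "g \<in> borel_measurable borel"
  shows "(\<integral>\<^sup>+X. (\<Prod>i\<in>{1..n}. g (X i)) \<partial>iid_law n f)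
    = (\<integral>\<^sup>+t. g t \<partial>density lborel (\<lambda>x. ennreal (f x))) ^ n"
proof -
  interpret product_prob_space "\<lambda>_. density lborel (\<lambda>x. ennreal (f x))"
    by (rule product_prob_space_density[OF f])
  show ?thesis unfolding iid_law_def by (subst product_nn_integral_prod) auto
qed

text \<open>
  The summands are bounded by \<open>4 / h\<close> and have second moment at most \<open>16 L / h\<close>. In the standardised
  average each exponent is at most \<open>8 / sqrt (n h)\<close> in absolute value, hence at most \<open>8\<close>, so a quadratic bound of the
  exponential applies with the factor \<open>exp 8\<close>. The \<open>n\<close> factors \<open>1 + 16 L exp 8 / n\<close> then
  multiply to a bounded quantity. An exponential moment gives all moments of order \<open>p\<close> at once.
\<close>

lemma onesided_kde_mgf:
  assumes f: "f \<in> holder_class \<beta> L" and L: "0 \<le> L" and x: "0 < x" "x \<le> 1"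
    and h: "0 < h" and nh: "1 \<le> real n * h" and s: "\<bar>s\<bar> = 1"
  defines "\<mu> \<equiv> \<integral>t. onesided_kernel ((t - x) / h) / h * f t \<partial>lborel"
  shows "(\<integral>\<^sup>+X. ennreal (exp (s * sqrt (real n * h) * (onesided_kde n h X x - \<mu>))) \<partial>iid_law n f)
    \<le> ennreal (exp (16 * L * exp 8))"
proof -
  define M where "M = density lborel (\<lambda>x. ennreal (f x))"
  have fd: "prob_density f" by (rule holder_class_D(1)[OF f])
  have fm [measurable]: "f \<in> borel_measurable borel" and f0: "\<And>x. 0 \<le> f x"
    using fd by (auto simp: prob_density_def)
  interpret M: prob_space M unfolding M_def by (rule prob_space_density[OF fd])
  have sM [measurable_cong, simp]: "sets M = sets borel" by (simp add: M_def)
  have n: "0 < n" using nh by (cases n) auto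
  define Y where "Y t = onesided_kernel ((t - x) / h) / h" for t
  have Ym [measurable]: "Y \<in> borel_measurable borel" unfolding Y_def by measurable
  have Yb: "\<bar>Y t\<bar> \<le> 4 / h" for t
  proof -
    have "\<bar>onesided_kernel ((t - x) / h)\<bar> \<le> 4"
      by (rule order_trans[OF abs_onesided_kernel_le]) (simp add: indicator_def)
    then show ?thesis using h by (simp add: Y_def divide_right_mono)
  qed
  have Y_int: "integrable M Y" "integrable M (\<lambda>t. (Y t)\<^sup>2)"
  proof -
    show "integrable M Y" using Yb by (intro M.integrable_const_bound[of _ "4 / h"]) auto
    have "(Y t)\<^sup>2 \<le> (4 / h)\<^sup>2" for t using Yb[of t] power_mono[OF Yb[of t], of 2] by simp
    then show "integrable M (\<lambda>t. (Y t)\<^sup>2)"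
      by (intro M.integrable_const_bound[of _ "(4 / h)\<^sup>2"]) auto
  qed
  have mu: "\<mu> = M.expectation Y"
    unfolding \<mu>_def M_def using f0 by (subst integral_density) (auto simp: Y_def mult.commute)
  have mub: "\<bar>\<mu>\<bar> \<le> 4 / h"
  proof -
    have "\<bar>M.expectation Y\<bar> \<le> M.expectation (\<lambda>t. \<bar>Y t\<bar>)" by (rule integral_abs_bound)
    also have "\<dots> \<le> 4 / h" using Yb Y_int by (intro M.integral_le_const) auto
    finally show ?thesis using mu by simp
  qed
  have var: "M.expectation (\<lambda>t. (Y t - \<mu>)\<^sup>2) \<le> 16 * L / h"
  proof -
    have "M.expectation (\<lambda>t. (Y t - \<mu>)\<^sup>2) \<le> M.expectation (\<lambda>t. (Y t)\<^sup>2)"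
      using M.variance_eq[OF Y_int] unfolding mu by simp
    also have "\<dots> = (\<integral>t. f t * (Y t)\<^sup>2 \<partial>lborel)"
      unfolding M_def using f0 by (subst integral_density) auto
    also have "\<dots> \<le> (\<integral>t. L * (16 / h\<^sup>2) * indicator {x..x + h} t \<partial>lborel)"
    proof (rule integral_mono)
      have "integrable lborel (\<lambda>t. f t *\<^sub>R (Y t)\<^sup>2)"
        using Y_int(2) f0 unfolding M_def by (subst (asm) integrable_density) auto
      then show "integrable lborel (\<lambda>t. f t * (Y t)\<^sup>2)" by simp
      show "f t * (Y t)\<^sup>2 \<le> L * (16 / h\<^sup>2) * indicator {x..x + h} t" for t
      proof (cases "t \<in> {x..x + h}")
        case True
        have "(Y t)\<^sup>2 \<le> (4 / h)\<^sup>2" using power_mono[OF Yb[of t], of 2] by simp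
        then have "f t * (Y t)\<^sup>2 \<le> L * (16 / h\<^sup>2)"
          using holder_class_D(3)[OF f, of t] True x f0[of t] by (intro mult_mono) (auto simp: power_divide)
        then show ?thesis using True by simp
      next
        case False
        then have "Y t = 0" using h by (auto simp: Y_def onesided_kernel_def indicator_def field_simps)
        then show ?thesis using False by simp
      qed
    qed (intro integrable_mult_right integrable_real_indicator, auto simp: emeasure_lborel_Icc_eq)
    also have "\<dots> = 16 * L / h" using h by (simp add: power2_eq_square)
    finally show ?thesis .
  qed
  define \<theta> where "\<theta> = s * sqrt (real n * h) / real n"
  have th2: "\<theta>\<^sup>2 = h / real n"
  proof -
    have "s\<^sup>2 = 1" using s by (metis power2_abs one_power2)
    moreover have "\<theta>\<^sup>2 = s\<^sup>2 * (real n * h) / (real n)\<^sup>2"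
      using h by (simp add: \<theta>_def power_divide power_mult_distrib)
    ultimately show ?thesis using n by (simp add: power2_eq_square)
  qed
  have thb: "\<bar>\<theta> * (Y t - \<mu>)\<bar> \<le> 8" for t
  proof -
    have "\<bar>Y t - \<mu>\<bar> \<le> 8 / h" using Yb[of t] mub by (simp add: abs_le_iff)
    from mult_left_mono[OF this, of "\<bar>\<theta>\<bar>"]
    have "\<bar>\<theta> * (Y t - \<mu>)\<bar> \<le> \<bar>\<theta>\<bar> * (8 / h)" by (simp add: abs_mult)
    moreover have "\<bar>\<theta>\<bar> / h \<le> 1"
    proof (rule power2_le_imp_le)
      have "(\<bar>\<theta>\<bar> / h)\<^sup>2 = 1 / (real n * h)" using th2 h by (simp add: power_divide power2_eq_square)
      also have "\<dots> \<le> 1" using nh by simp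
      finally show "(\<bar>\<theta>\<bar> / h)\<^sup>2 \<le> 1\<^sup>2" by simp
    qed simp
    moreover have "\<bar>\<theta>\<bar> * (8 / h) = 8 * (\<bar>\<theta>\<bar> / h)" by simp
    ultimately show ?thesis by linarith
  qed
  have single: "(\<integral>\<^sup>+t. ennreal (exp (\<theta> * (Y t - \<mu>))) \<partial>M) \<le> ennreal (exp (16 * L * exp 8 / real n))"
  proof -
    \<comment> \<open>linear term has mean \<open>0\<close>, quadratic term gives the variance\<close>
    define q where "q t = 1 + \<theta> * (Y t - \<mu>) + \<theta>\<^sup>2 * exp 8 * (Y t - \<mu>)\<^sup>2" for t
    have q: "exp (\<theta> * (Y t - \<mu>)) \<le> q t" for t
      using exp_le_quadratic[OF thb[of t]] by (simp add: q_def power_mult_distrib mult_ac)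
    have q0: "0 \<le> q t" for t by (rule order_trans[OF less_imp_le[OF exp_gt_zero] q])
    have i2: "integrable M (\<lambda>t. (Y t - \<mu>)\<^sup>2)" using Y_int by (simp add: power2_diff)
    have qi: "integrable M q" unfolding q_def using Y_int i2 by simp
    have "(\<integral>\<^sup>+t. ennreal (exp (\<theta> * (Y t - \<mu>))) \<partial>M) \<le> (\<integral>\<^sup>+t. ennreal (q t) \<partial>M)"
      using q by (intro nn_integral_mono ennreal_leI)
    also have "\<dots> = ennreal (M.expectation q)"
      using qi by (intro nn_integral_eq_integral) (auto intro: q0)
    also have "M.expectation q = 1 + \<theta>\<^sup>2 * exp 8 * M.expectation (\<lambda>t. (Y t - \<mu>)\<^sup>2)"
      unfolding q_def using Y_int i2 by (simp add: mu M.prob_space)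
    also have "\<dots> \<le> 1 + \<theta>\<^sup>2 * exp 8 * (16 * L / h)"
      using var by (intro add_left_mono mult_left_mono) auto
    also have "\<dots> = 1 + 16 * L * exp 8 / real n" using th2 h by simp
    also have "\<dots> \<le> exp (16 * L * exp 8 / real n)" by (rule exp_ge_add_one_self)
    finally show ?thesis by (simp add: ennreal_leI)
  qed
  have "exp (s * sqrt (real n * h) * (onesided_kde n h X x - \<mu>)) = (\<Prod>i\<in>{1..n}. exp (\<theta> * (Y (X i) - \<mu>)))" for X
  proof -
    have "(\<Prod>i\<in>{1..n}. exp (\<theta> * (Y (X i) - \<mu>))) = exp (\<Sum>i\<in>{1..n}. \<theta> * (Y (X i) - \<mu>))"
      by (rule exp_sum[symmetric]) simp
    also have "(\<Sum>i\<in>{1..n}. \<theta> * (Y (X i) - \<mu>)) = \<theta> * ((\<Sum>i\<in>{1..n}. Y (X i)) - real n * \<mu>)"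
      by (simp add: sum_distrib_left[symmetric] sum_subtractf)
    also have "\<dots> = s * sqrt (real n * h) * (onesided_kde n h X x - \<mu>)"
      using n x by (simp add: \<theta>_def onesided_kde_def Y_def field_simps)
    finally show ?thesis by simp
  qed
  then have "(\<integral>\<^sup>+X. ennreal (exp (s * sqrt (real n * h) * (onesided_kde n h X x - \<mu>))) \<partial>iid_law n f)
      = (\<integral>\<^sup>+X. (\<Prod>i\<in>{1..n}. ennreal (exp (\<theta> * (Y (X i) - \<mu>)))) \<partial>iid_law n f)"
    by (simp add: prod_ennreal)
  also have "\<dots> = (\<integral>\<^sup>+t. ennreal (exp (\<theta> * (Y t - \<mu>))) \<partial>M) ^ n"
    unfolding M_def by (rule nn_integral_iid_law_prod[OF fd]) measurable
  also have "\<dots> \<le> ennreal (exp (16 * L * exp 8 / real n)) ^ n" by (intro power_mono single) simp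
  also have "\<dots> = ennreal (exp (16 * L * exp 8))"
    using n by (simp add: ennreal_power exp_of_nat_mult[symmetric])
  finally show ?thesis .
qed

lemma onesided_kde_pointwise_risk:
  assumes f: "f \<in> holder_class \<beta> L" and \<beta>: "0 < \<beta>" "\<beta> \<le> 2" and L: "0 \<le> L" and x: "0 < x" "x \<le> 1"
    and h: "0 < h" and nh: "1 \<le> real n * h" and p: "1 \<le> p"
  shows "pointwise_risk p n (onesided_kde n h) f x
    \<le> ennreal (2 powr p * (2 * p powr p * exp (16 * L * exp 8) * (real n * h) powr (- p / 2)
        + (4 * L * h powr \<beta>) powr p))"
proof -
  have fd: "prob_density f" by (rule holder_class_D(1)[OF f])
  interpret P: prob_space "iid_law n f" by (rule prob_space_iid_law[OF fd])
  define \<mu> where "\<mu> = (\<integral>t. onesided_kernel ((t - x) / h) / h * f t \<partial>lborel)"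
  define l where "l = sqrt (real n * h)"
  have l: "0 < l" using nh by (simp add: l_def)
  define A where "A = 2 powr p * p powr p * l powr (- p)"
  define B where "B = 2 powr p * (4 * L * h powr \<beta>) powr p"
  define D where "D X = onesided_kde n h X x - \<mu>" for X
  have [measurable]: "D \<in> borel_measurable (iid_law n f)"
  proof -
    have "D \<in> borel_measurable (\<Pi>\<^sub>M i\<in>{1..n}. borel)"
      unfolding D_def onesided_kde_def by measurable
    then show ?thesis by (simp cong: measurable_cong_sets add: sets_iid_law)
  qed
  have pt: "\<bar>onesided_kde n h X x - f x\<bar> powr p \<le> A * (exp (1 * l * D X) + exp (- 1 * l * D X)) + B" for X
  proof -
    have "(\<bar>onesided_kde n h X x - f x\<bar> / 2) powr p \<le> \<bar>D X\<bar> powr p + \<bar>f x - \<mu>\<bar> powr p"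
      using half_diff_powr_le[of p "D X" "f x - \<mu>"] p by (simp add: D_def)
    moreover have "\<bar>f x - \<mu>\<bar> powr p \<le> (4 * L * h powr \<beta>) powr p"
      using onesided_kernel_bias[OF f \<beta> L x(1) h] p
      by (intro powr_mono2) (auto simp: \<mu>_def abs_minus_commute)
    moreover have "\<bar>D X\<bar> powr p \<le> l powr (- p) * (p powr p * (exp (1 * l * D X) + exp (- 1 * l * D X)))"
    proof -
      have "\<bar>D X\<bar> powr p = l powr (- p) * (l * \<bar>D X\<bar>) powr p"
        using l by (simp add: powr_mult powr_minus)
      also have "(l * \<bar>D X\<bar>) powr p \<le> p powr p * exp (l * \<bar>D X\<bar>)"
        using p l by (intro powr_le_exp) auto
      also have "exp (l * \<bar>D X\<bar>) \<le> exp (1 * l * D X) + exp (- 1 * l * D X)"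
        by (cases "0 \<le> D X") (auto simp: add_increasing add_increasing2)
      finally show ?thesis using l p by (simp add: mult_left_mono)
    qed
    ultimately have "(\<bar>onesided_kde n h X x - f x\<bar> / 2) powr p
        \<le> l powr (- p) * (p powr p * (exp (1 * l * D X) + exp (- 1 * l * D X))) + (4 * L * h powr \<beta>) powr p"
      by linarith
    from mult_left_mono[OF this, of "2 powr p"] show ?thesis
      by (simp add: powr_divide A_def B_def algebra_simps)
  qed
  have AB: "0 \<le> A" "0 \<le> B" by (auto simp: A_def B_def)
  define c where "c = exp (16 * L * exp 8)"
  have "pointwise_risk p n (onesided_kde n h) f x
      \<le> (\<integral>\<^sup>+X. ennreal A * (ennreal (exp (1 * l * D X)) + ennreal (exp (- 1 * l * D X))) + ennreal B \<partial>iid_law n f)"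
    unfolding pointwise_risk_def
  proof (rule nn_integral_mono)
    fix X
    have "ennreal (\<bar>onesided_kde n h X x - f x\<bar> powr p)
      \<le> ennreal (A * (exp (1 * l * D X) + exp (- 1 * l * D X)) + B)" by (rule ennreal_leI[OF pt])
    also have "\<dots> = ennreal A * (ennreal (exp (1 * l * D X)) + ennreal (exp (- 1 * l * D X))) + ennreal B"
      using AB by (simp add: ennreal_plus ennreal_mult)
    finally show "ennreal (\<bar>onesided_kde n h X x - f x\<bar> powr p)
      \<le> ennreal A * (ennreal (exp (1 * l * D X)) + ennreal (exp (- 1 * l * D X))) + ennreal B" .
  qed
  also have "\<dots> = ennreal A * ((\<integral>\<^sup>+X. ennreal (exp (1 * l * D X)) \<partial>iid_law n f)
      + (\<integral>\<^sup>+X. ennreal (exp (- 1 * l * D X)) \<partial>iid_law n f)) + ennreal B"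
    by (simp add: nn_integral_add nn_integral_cmult P.emeasure_space_1)
  also have "\<dots> \<le> ennreal A * (ennreal c + ennreal c) + ennreal B"
    unfolding c_def D_def l_def \<mu>_def
    by (intro add_mono mult_left_mono onesided_kde_mgf[OF f L x h nh]) auto
  also have "\<dots> = ennreal (A * (c + c) + B)"
    using AB by (simp add: c_def ennreal_plus[symmetric] ennreal_mult[symmetric] del: ennreal_plus)
  also have "A * (c + c) + B = 2 powr p * (2 * p powr p * c * l powr (- p) + (4 * L * h powr \<beta>) powr p)"
    by (simp add: A_def B_def algebra_simps)
  also have "l powr (- p) = (real n * h) powr (- p / 2)"
    using nh by (simp add: l_def powr_half_sqrt[symmetric] powr_powr)
  finally show ?thesis by (simp add: c_def)
qed

text \<open>
  The bandwidth \<open>n powr (- 1 / (2 \<beta> + 1))\<close> balances the bias \<open>h powr \<beta>\<close> against the stochastic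
  error \<open>(n h) powr (- 1/2)\<close>.
\<close>

lemma minimax_risk_upper_bound:
  assumes p: "1 \<le> p" and \<beta>: "0 < \<beta>" "\<beta> \<le> 2" and L: "0 \<le> L"
  shows "\<exists>C>0. \<forall>n\<ge>1. minimax_risk p n (holder_class \<beta> L) \<le> ennreal (C * real n powr (- \<beta> / (2 * \<beta> + 1)))"
proof -
  define K where "K = 2 powr p * (2 * p powr p * exp (16 * L * exp 8) + (4 * L) powr p)"
  have K: "0 < K" using p by (auto simp: K_def intro!: mult_pos_pos add_pos_nonneg)
  have "minimax_risk p n (holder_class \<beta> L) \<le> ennreal (K powr (1 / p) * real n powr (- \<beta> / (2 * \<beta> + 1)))"
    if n: "1 \<le> n" for n :: nat
  proof -
    define h where "h = real n powr (- 1 / (2 * \<beta> + 1))"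
    define q where "q = real n powr (- \<beta> / (2 * \<beta> + 1))"
    have n1: "1 \<le> real n" using n by simp
    have h: "0 < h" using n by (simp add: h_def)
    have nh: "real n * h = real n powr (2 * \<beta> / (2 * \<beta> + 1))"
    proof -
      have "real n * h = real n powr (1 + (- 1 / (2 * \<beta> + 1)))" using n1 by (simp add: h_def powr_mult_base)
      also have "1 + (- 1 / (2 * \<beta> + 1)) = 2 * \<beta> / (2 * \<beta> + 1)" using \<beta> by (simp add: field_simps)
      finally show ?thesis .
    qed
    have nh1: "1 \<le> real n * h" unfolding nh using n1 \<beta> by (intro ge_one_powr_ge_zero) auto
    have e1: "h powr \<beta> = q" by (simp add: h_def q_def powr_powr)
    have e2: "(real n * h) powr (- p / 2) = q powr p"
    proof -
      have "2 * \<beta> / (2 * \<beta> + 1) * (- p / 2) = - \<beta> / (2 * \<beta> + 1) * p"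
        using \<beta> by (simp add: divide_simps)
      then show ?thesis unfolding nh q_def powr_powr by (rule arg_cong)
    qed
    have q0: "0 \<le> q" by (simp add: q_def)
    have e3: "2 powr p * (2 * p powr p * exp (16 * L * exp 8) * (real n * h) powr (- p / 2)
        + (4 * L * h powr \<beta>) powr p) = (K powr (1 / p) * q) powr p"
      unfolding e1 e2 using K L p q0 by (simp add: powr_mult powr_powr K_def algebra_simps)
    have "max_risk p n (onesided_kde n h) (holder_class \<beta> L) \<le> ennreal (K powr (1 / p) * q)"
    proof (rule max_risk_upper_bound[OF onesided_kde_in_estimators])
      fix f assume f: "f \<in> holder_class \<beta> L"
      show "prob_density f" by (rule holder_class_D(1)[OF f])
      have "(\<integral>\<^sup>+x\<in>{0..}. pointwise_risk p n (onesided_kde n h) f x \<partial>lborel)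
        \<le> (\<integral>\<^sup>+x. ennreal ((K powr (1 / p) * q) powr p) * indicator {0..1::real} x \<partial>lborel)"
      proof (rule nn_integral_mono_AE)
        show "AE x in lborel. pointwise_risk p n (onesided_kde n h) f x * indicator {0..} x
          \<le> ennreal ((K powr (1 / p) * q) powr p) * indicator {0..1::real} x"
          using AE_lborel_singleton[of "0::real"]
        proof eventually_elim
          fix x :: real assume "x \<noteq> 0"
          then consider "x < 0" | "0 < x" "x \<le> 1" | "1 < x" by linarith
          then show "pointwise_risk p n (onesided_kde n h) f x * indicator {0..} x
            \<le> ennreal ((K powr (1 / p) * q) powr p) * indicator {0..1::real} x"
          proof cases
            case 2
            then show ?thesis using onesided_kde_pointwise_risk[OF f \<beta> L 2 h nh1 p] unfolding e3 by simp
          next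
            case 3
            then have "pointwise_risk p n (onesided_kde n h) f x = 0"
              using holder_class_D(2)[OF f, of x] by (simp add: pointwise_risk_def onesided_kde_def)
            then show ?thesis by simp
          qed simp
        qed
      qed
      also have "\<dots> = ennreal ((K powr (1 / p) * q) powr p)"
        by (subst nn_integral_cmult_indicator) auto
      finally show "(\<integral>\<^sup>+x\<in>{0..}. pointwise_risk p n (onesided_kde n h) f x \<partial>lborel)
        \<le> ennreal ((K powr (1 / p) * q) powr p)" .
    qed (use p q0 in auto)
    then show ?thesis unfolding minimax_risk_def q_def
      by (intro INF_lower2[OF onesided_kde_in_estimators[of n h]])
  qed
  then show ?thesis using K by (intro exI[of _ "K powr (1 / p)"]) auto
qed

section \<open>The gamma kernel\<close>

lemma has_bochner_integral_gamma_moment: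
  fixes s b :: real
  assumes s: "0 < s" and b: "0 < b"
  shows "has_bochner_integral lborel (\<lambda>t. indicator {0..} t * (t powr (s - 1) * exp (- t / b))) (Gamma s * b powr s)"
proof -
  have "has_bochner_integral lborel (\<lambda>t::real. indicator {0..} t * t powr (s - 1) / exp t) (Gamma s)"
    by (intro has_bochner_integral_nn_integral)
      (use Gamma_conv_nn_integral_real[OF s] Gamma_real_pos[OF s] in auto)
  then have "has_bochner_integral lborel (\<lambda>t::real. indicator {0..} (0 + 1 / b * t) * (0 + 1 / b * t) powr (s - 1) / exp (0 + 1 / b * t))
      (Gamma s /\<^sub>R \<bar>1 / b\<bar>)"
    using b by (subst (asm) lborel_has_bochner_integral_real_affine_iff[of "1 / b" _ _ 0]) auto
  then have "has_bochner_integral lborel (\<lambda>t. b powr (s - 1) *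
      (indicator {0..} (0 + 1 / b * t) * (0 + 1 / b * t) powr (s - 1) / exp (0 + 1 / b * t)))
      (b powr (s - 1) * (Gamma s /\<^sub>R \<bar>1 / b\<bar>))"
    by (rule has_bochner_integral_mult_right)
  moreover have "b powr (s - 1) * (Gamma s /\<^sub>R \<bar>1 / b\<bar>) = Gamma s * b powr s"
    using b powr_mult_base[of b "s - 1"] by (simp add: mult_ac)
  moreover have "b powr (s - 1) * (indicator {0..} (0 + 1 / b * t) * (0 + 1 / b * t) powr (s - 1) / exp (0 + 1 / b * t))
      = indicator {0..} t * (t powr (s - 1) * exp (- t / b))" for t
  proof -
    have "0 + 1 / b * t = t / b" by simp
    moreover have "indicator {0..} (t / b) = (indicator {0..} t :: real)"
      using b by (simp add: indicator_def zero_le_divide_iff)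
    ultimately show ?thesis using b by (simp add: powr_divide exp_minus indicator_def field_simps)
  qed
  ultimately show ?thesis by (simp only:)
qed

lemma gamma_kernel_nonneg: "0 < b \<Longrightarrow> 0 \<le> x \<Longrightarrow> 0 \<le> gamma_kernel b x t"
  unfolding gamma_kernel_def by (auto intro!: mult_nonneg_nonneg divide_nonneg_pos mult_pos_pos Gamma_real_pos add_nonneg_pos)

lemma has_bochner_integral_gamma_kernel_powr:
  assumes b: "0 < b" and x: "0 < x" and r: "0 < x / b + 1 + r"
  shows "has_bochner_integral lborel (\<lambda>t. gamma_kernel b x t * t powr r)
    (Gamma (x / b + 1 + r) * b powr r / Gamma (x / b + 1))"
proof -
  define a where "a = x / b"
  have a: "0 < a" using b x by (simp add: a_def)
  have G: "0 < Gamma (a + 1)" using a by (intro Gamma_real_pos) simp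
  from has_bochner_integral_mult_right[OF has_bochner_integral_gamma_moment[of "a + 1 + r" b],
      of "1 / (b powr (a + 1) * Gamma (a + 1))"]
  have "has_bochner_integral lborel (\<lambda>t. 1 / (b powr (a + 1) * Gamma (a + 1)) *
      (indicator {0..} t * (t powr (a + 1 + r - 1) * exp (- t / b))))
      (1 / (b powr (a + 1) * Gamma (a + 1)) * (Gamma (a + 1 + r) * b powr (a + 1 + r)))"
    using b r by (simp add: a_def)
  moreover have "(1 / (b powr (a + 1) * Gamma (a + 1)) * (Gamma (a + 1 + r) * b powr (a + 1 + r)))
      = Gamma (a + 1 + r) * b powr r / Gamma (a + 1)"
    using b by (simp add: powr_add)
  moreover have "1 / (b powr (a + 1) * Gamma (a + 1)) * (indicator {0..} t * (t powr (a + 1 + r - 1) * exp (- t / b)))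
      = gamma_kernel b x t * t powr r" for t
  proof -
    have "t powr (a + 1 + r - 1) = t powr a * t powr r" by (simp add: powr_add[symmetric])
    then show ?thesis using x by (simp add: gamma_kernel_def a_def)
  qed
  ultimately show ?thesis by (simp add: a_def)
qed

lemma gamma_kernel_0 [simp]: "0 < x \<Longrightarrow> gamma_kernel b x 0 = 0"
  by (simp add: gamma_kernel_def)

lemma gamma_kernel_neg [simp]: "t < 0 \<Longrightarrow> gamma_kernel b x t = 0"
  by (simp add: gamma_kernel_def)

text \<open>
  As a function of \<open>t\<close> the kernel is the density of a gamma distribution with shape
  \<open>x / b + 1\<close> and scale \<open>b\<close>. Its moments replace any asymptotics of the gamma
  function in what follows.
\<close>

lemma gamma_kernel_moments:
  assumes b: "0 < b" and x: "0 < x"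
  shows "has_bochner_integral lborel (gamma_kernel b x) 1"
    and "has_bochner_integral lborel (\<lambda>t. gamma_kernel b x t * t) (x + b)"
    and "has_bochner_integral lborel (\<lambda>t. gamma_kernel b x t * t\<^sup>2) ((x + b) * (x + 2 * b))"
    and "has_bochner_integral lborel (\<lambda>t. gamma_kernel b x t / t) (1 / x)"
    and "b < x \<Longrightarrow> has_bochner_integral lborel (\<lambda>t. gamma_kernel b x t / t\<^sup>2) (1 / (x * (x - b)))"
proof -
  define a where "a = x / b"
  have a: "0 < a" using b x by (simp add: a_def)
  have xa: "x = a * b" using b by (simp add: a_def)
  have G: "0 < Gamma (a + 1)" using a by (intro Gamma_real_pos) simp
  have np: "z \<notin> \<int>\<^sub>\<le>\<^sub>0" if "0 < z" for z :: real using that by (auto elim!: nonpos_Ints_cases)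
  have G1: "Gamma (a + 1 + 1) = (a + 1) * Gamma (a + 1)" using a by (intro Gamma_plus1 np) simp
  have G2: "Gamma (a + 1 + 2) = (a + 2) * ((a + 1) * Gamma (a + 1))"
    using Gamma_plus1[OF np, of "a + 1 + 1"] G1 a by (simp add: add.assoc)
  have G3: "Gamma (a + 1) = a * Gamma a" using a by (intro Gamma_plus1 np) simp
  note m = has_bochner_integral_gamma_kernel_powr[OF b x, folded a_def]
  have e: "gamma_kernel b x t * t powr r = gamma_kernel b x t * q" if "t > 0 \<Longrightarrow> t powr r = q" for t r q
    using that x by (cases "t > 0"; cases "t = 0") auto
  have "(\<lambda>t. gamma_kernel b x t * t powr 0) = gamma_kernel b x" using e[of _ 0 1] by auto
  with m[of 0] show "has_bochner_integral lborel (gamma_kernel b x) 1" using a G b by simp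
  have "(\<lambda>t. gamma_kernel b x t * t powr 1) = (\<lambda>t. gamma_kernel b x t * t)" using e[of _ 1] by auto
  moreover have "Gamma (a + 1 + 1) * b powr 1 / Gamma (a + 1) = x + b"
  proof -
    have "(a + 1) * Gamma (a + 1) * b powr 1 / Gamma (a + 1) = (a + 1) * b" using G b by simp
    then show ?thesis unfolding G1 by (simp add: xa distrib_right)
  qed
  ultimately show "has_bochner_integral lborel (\<lambda>t. gamma_kernel b x t * t) (x + b)"
    using m[of 1] a by simp
  have "(\<lambda>t. gamma_kernel b x t * t powr 2) = (\<lambda>t. gamma_kernel b x t * t\<^sup>2)"
    by (intro ext e) (simp add: powr_numeral)
  moreover have "Gamma (a + 1 + 2) * b powr 2 / Gamma (a + 1) = (x + b) * (x + 2 * b)"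
  proof -
    have "(a + 2) * ((a + 1) * Gamma (a + 1)) * b powr 2 / Gamma (a + 1) = (a + 2) * (a + 1) * b\<^sup>2"
      using G b by (simp add: powr_numeral)
    then show ?thesis unfolding G2 by (simp add: xa power2_eq_square algebra_simps)
  qed
  ultimately show "has_bochner_integral lborel (\<lambda>t. gamma_kernel b x t * t\<^sup>2) ((x + b) * (x + 2 * b))"
    using m[of 2] a by simp
  have "(\<lambda>t. gamma_kernel b x t * t powr (-1)) = (\<lambda>t. gamma_kernel b x t / t)"
    unfolding divide_inverse by (intro ext e) (simp add: powr_minus)
  moreover have "Gamma (a + 1 + - 1) * b powr (- 1) / Gamma (a + 1) = 1 / x"
    unfolding G3 using Gamma_real_pos[OF a] b by (simp add: xa powr_minus divide_inverse)
  ultimately show "has_bochner_integral lborel (\<lambda>t. gamma_kernel b x t / t) (1 / x)"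
    using m[of "-1"] a by simp
  assume "b < x"
  then have a1: "1 < a" using b by (simp add: a_def)
  then have G4: "Gamma (a + 1) = a * ((a - 1) * Gamma (a - 1))" "0 < Gamma (a - 1)"
    using Gamma_plus1[OF np, of "a - 1"] G3 by (auto intro: Gamma_real_pos)
  have "(\<lambda>t. gamma_kernel b x t * t powr (-2)) = (\<lambda>t. gamma_kernel b x t / t\<^sup>2)"
    unfolding divide_inverse by (intro ext e) (simp add: powr_minus powr_numeral)
  moreover have "Gamma (a + 1 + - 2) * b powr (- 2) / Gamma (a + 1) = 1 / (x * (x - b))"
  proof -
    have "Gamma (a + 1 + - 2) = Gamma (a - 1)" by simp
    moreover have "x * (x - b) = a * (a - 1) * b\<^sup>2" by (simp add: xa power2_eq_square algebra_simps)
    ultimately show ?thesis using G4 b by (simp add: powr_minus powr_numeral divide_inverse)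
  qed
  ultimately show "has_bochner_integral lborel (\<lambda>t. gamma_kernel b x t / t\<^sup>2) (1 / (x * (x - b)))"
    using m[of "-2"] a1 by simp
qed

lemma has_bochner_integral_gamma_kernel_variance:
  assumes b: "0 < b" and x: "0 < x"
  shows "has_bochner_integral lborel (\<lambda>t. gamma_kernel b x t * (t - x)\<^sup>2) (b * x + 2 * b\<^sup>2)"
proof -
  note m = gamma_kernel_moments[OF b x]
  from has_bochner_integral_add[OF has_bochner_integral_diff[OF m(3) has_bochner_integral_mult_right[OF m(2), of "2 * x"]]
      has_bochner_integral_mult_right[OF m(1), of "x\<^sup>2"]]
  show ?thesis by (simp add: power2_eq_square algebra_simps)
qed

text \<open>
  The derivative in \<open>t\<close>, where \<open>t > 0\<close>.
\<close>

definition gamma_kernel_deriv :: "real \<Rightarrow> real \<Rightarrow> real \<Rightarrow> real" where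
  "gamma_kernel_deriv b x t = gamma_kernel b x t * (x / t - 1) / b"

lemma DERIV_gamma_kernel:
  assumes b: "0 < b" and x: "0 < x" and t: "0 < t"
  shows "(gamma_kernel b x has_real_derivative gamma_kernel_deriv b x t) (at t)"
proof -
  define N where "N = b powr (x / b + 1) * Gamma (x / b + 1)"
  define a where "a = x / b"
  have "((\<lambda>t. t powr a * exp (- t / b)) has_real_derivative
      t powr a * exp (- t / b) * (a / t - 1 / b)) (at t)"
    using t b by (auto intro!: derivative_eq_intros simp: powr_diff algebra_simps)
  moreover have "a / t - 1 / b = (x / t - 1) / b" using b by (simp add: a_def diff_divide_distrib)
  ultimately have "((\<lambda>t. t powr (x / b) * exp (- t / b)) has_real_derivative
      t powr (x / b) * exp (- t / b) * ((x / t - 1) / b)) (at t)" by (simp add: a_def)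
  from DERIV_cdivide[OF this, of N]
  have "((\<lambda>t. t powr (x / b) * exp (- t / b) / N) has_real_derivative gamma_kernel_deriv b x t) (at t)"
    using x t by (simp add: gamma_kernel_deriv_def gamma_kernel_def N_def mult_ac)
  then show ?thesis
    by (rule has_field_derivative_transform_within_open[where S = "{0<..}"])
      (use t x in \<open>auto simp: gamma_kernel_def N_def\<close>)
qed

lemma continuous_on_gamma_kernel:
  assumes b: "0 < b" and x: "0 < x"
  shows "continuous_on {0..} (gamma_kernel b x)"
proof -
  have "0 < Gamma (x / b + 1)" using b x by (intro Gamma_real_pos add_pos_pos) auto
  then have G: "Gamma (x / b + 1) \<noteq> 0" by simp
  have "continuous_on {0..} (\<lambda>t. t powr (x / b) * exp (- t / b) / (b powr (x / b + 1) * Gamma (x / b + 1)))"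
    using b x G by (auto intro!: continuous_intros continuous_on_powr')
  then show ?thesis
    by (rule continuous_on_eq) (use x in \<open>auto simp: gamma_kernel_def\<close>)
qed

lemma abs_le_weighted_square: "\<bar>y\<bar> \<le> (y\<^sup>2 / s + s) / 2" if "0 < s" for y s :: real
proof -
  have "0 \<le> (\<bar>y\<bar> - s)\<^sup>2" by simp
  then have "2 * \<bar>y\<bar> * s \<le> y\<^sup>2 + s\<^sup>2" by (simp add: power2_diff)
  then show ?thesis using that by (simp add: field_simps power2_eq_square)
qed

text \<open>
  The integral of the absolute derivative is the mean of \<open>\<bar>x / T - 1\<bar> / b\<close> for a gamma variable
  \<open>T\<close>. The quotient \<open>x / T\<close> has mean \<open>1\<close> and, for \<open>b < x\<close>, variance \<open>b / (x - b)\<close>, so the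
  integral is of order \<open>1 / sqrt b\<close> if \<open>b\<close> is small. If \<open>b > 1/8\<close>, the second
  moment of \<open>x / T\<close> may be infinite, but the first moment already gives \<open>2 / b\<close>.
\<close>

lemma gamma_kernel_deriv_dominated:
  assumes b: "0 < b" "b < 1" and x: "1/4 \<le> x" "x \<le> 1/2"
  obtains Q where "integrable lborel Q" "integral\<^sup>L lborel Q \<le> 6 / sqrt b" "\<And>t. 0 \<le> Q t"
    "\<And>t. \<bar>gamma_kernel_deriv b x t\<bar> \<le> Q t"
proof (cases "b \<le> 1/8")
  case True
  have x0: "0 < x" "b < x" using x True by auto
  note m = gamma_kernel_moments[OF b(1) x0(1)]
  define s where "s = sqrt b"
  have s: "0 < s" "s * s = b" using b by (auto simp: s_def)
  define Q where "Q t = gamma_kernel b x t * (((x / t - 1)\<^sup>2 / s + s) / 2) / b" for t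
  have "has_bochner_integral lborel (\<lambda>t. x\<^sup>2 * (gamma_kernel b x t / t\<^sup>2) - 2 * x * (gamma_kernel b x t / t)
      + gamma_kernel b x t) (x\<^sup>2 * (1 / (x * (x - b))) - 2 * x * (1 / x) + 1)"
    using x0 by (intro has_bochner_integral_add has_bochner_integral_diff has_bochner_integral_mult_right m)
  then have "has_bochner_integral lborel (\<lambda>t. gamma_kernel b x t * (x / t - 1)\<^sup>2) (b / (x - b))"
  proof (rule has_bochner_integral_cong[THEN iffD1, rotated -1])
    show "x\<^sup>2 * (gamma_kernel b x t / t\<^sup>2) - 2 * x * (gamma_kernel b x t / t) + gamma_kernel b x t
        = gamma_kernel b x t * (x / t - 1)\<^sup>2" for t
      using x0 by (cases "t = 0") (auto simp: field_simps power2_eq_square)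
    show "x\<^sup>2 * (1 / (x * (x - b))) - 2 * x * (1 / x) + 1 = b / (x - b)"
      using x0 by (simp add: field_simps power2_eq_square)
  qed simp
  from has_bochner_integral_add[OF has_bochner_integral_mult_right[OF this, of "1 / (2 * s * b)"]
      has_bochner_integral_mult_right[OF m(1), of "s / (2 * b)"]]
  have "has_bochner_integral lborel Q (1 / (2 * s * b) * (b / (x - b)) + s / (2 * b) * 1)"
  proof (rule has_bochner_integral_cong[THEN iffD1, rotated -1])
    show "1 / (2 * s * b) * (gamma_kernel b x t * (x / t - 1)\<^sup>2) + s / (2 * b) * gamma_kernel b x t = Q t" for t
      using s(1) b by (simp add: Q_def field_simps)
  qed simp_all
  moreover have "1 / (2 * s * b) * (b / (x - b)) + s / (2 * b) * 1 \<le> 6 / s"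
  proof -
    have "1 / (x - b) \<le> 8" using x True by (simp add: field_simps)
    then have "1 / (2 * s) * (1 / (x - b)) \<le> 1 / (2 * s) * 8" using s by (intro mult_left_mono) auto
    moreover have "s / (2 * b) = 1 / (2 * s)" unfolding s(2)[symmetric] using s(1) by simp
    moreover have "1 / (2 * s * b) * (b / (x - b)) = 1 / (2 * s) * (1 / (x - b))" using b by simp
    moreover have "1 / (2 * s) * 8 + 1 / (2 * s) \<le> 6 / s" using s by (simp add: field_simps)
    ultimately show ?thesis by simp
  qed
  ultimately show ?thesis
  proof (intro that[of Q])
    show "0 \<le> Q t" for t
      unfolding Q_def using gamma_kernel_nonneg[of b x t] b x0 s by simp
    show "\<bar>gamma_kernel_deriv b x t\<bar> \<le> Q t" for t
    proof -
      have K: "0 \<le> gamma_kernel b x t" using gamma_kernel_nonneg[of b x t] b x0 by simp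
      have "gamma_kernel b x t * \<bar>x / t - 1\<bar> / b \<le> Q t"
        unfolding Q_def using b
        by (intro divide_right_mono mult_left_mono abs_le_weighted_square s K) auto
      then show ?thesis using K b by (simp add: gamma_kernel_deriv_def abs_mult)
    qed
  qed (auto simp: has_bochner_integral_iff s_def)
next
  case False
  have x0: "0 < x" using x by auto
  note m = gamma_kernel_moments[OF b(1) x0(1)]
  define Q where "Q t = x / b * (gamma_kernel b x t / t) + 1 / b * gamma_kernel b x t" for t
  have "has_bochner_integral lborel Q (x / b * (1 / x) + 1 / b * 1)"
    unfolding Q_def by (intro has_bochner_integral_add has_bochner_integral_mult_right m)
  moreover have "x / b * (1 / x) + 1 / b * 1 \<le> 6 / sqrt b"
  proof -
    have "1/3 \<le> sqrt b" using False by (intro real_le_rsqrt) (simp add: power2_eq_square)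
    then have "1/3 * sqrt b \<le> sqrt b * sqrt b" using b by (intro mult_right_mono) auto
    then have "2 * sqrt b \<le> 6 * (sqrt b * sqrt b)" by linarith
    then have "2 / b \<le> 6 / sqrt b" using b by (simp add: field_simps)
    then show ?thesis using x0 by simp
  qed
  moreover have Q0: "0 \<le> gamma_kernel b x t / t" for t
    using gamma_kernel_nonneg[of b x t] b x0 by (cases "t \<ge> 0") auto
  moreover have "\<bar>gamma_kernel_deriv b x t\<bar> \<le> Q t" for t
  proof -
    have K: "0 \<le> gamma_kernel b x t" using gamma_kernel_nonneg[of b x t] b x0 by simp
    have "gamma_kernel_deriv b x t = x / b * (gamma_kernel b x t / t) - 1 / b * gamma_kernel b x t"
      by (simp add: gamma_kernel_deriv_def algebra_simps diff_divide_distrib)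
    moreover have "0 \<le> x / b * (gamma_kernel b x t / t)"
      by (intro mult_nonneg_nonneg Q0) (use b x0 in auto)
    moreover have "0 \<le> 1 / b * gamma_kernel b x t" using K b by simp
    ultimately show ?thesis unfolding Q_def by linarith
  qed
  ultimately show ?thesis
  proof (intro that[of Q])
    show "0 \<le> Q t" for t
      unfolding Q_def using Q0[of t] gamma_kernel_nonneg[of b x t] b x0 by (intro add_nonneg_nonneg mult_nonneg_nonneg) auto
  qed (auto simp: has_bochner_integral_iff)
qed

text \<open>
  Integration by parts moves the derivative from the primitive of the wiggle, which is of
  order \<open>w powr (- \<beta>) / w\<close>, to the kernel. There are no boundary terms because the primitive vanishes at
  both ends.
\<close>

lemma gamma_kernel_smooths_wiggle:
  assumes b: "0 < b" "b < 1" and x: "1/4 \<le> x" "x \<le> 1/2" and w: "w = 4 * pi * real k" "0 < k"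
  shows "integrable lborel (\<lambda>t. gamma_kernel b x t * wiggle \<beta> w t)"
    and "\<bar>\<integral>t. gamma_kernel b x t * wiggle \<beta> w t \<partial>lborel\<bar> \<le> 2 * w powr (- \<beta>) / (w * sqrt b)"
proof -
  have x0: "0 < x" using x by simp
  have w0: "0 < w" using w by simp
  obtain Q where Q: "integrable lborel Q" "integral\<^sup>L lborel Q \<le> 6 / sqrt b" "\<And>t. 0 \<le> Q t"
    "\<And>t. \<bar>gamma_kernel_deriv b x t\<bar> \<le> Q t"
    using gamma_kernel_deriv_dominated[OF b x] by blast
  define a where "a = w powr (- \<beta>) / 4"
  define g where "g t = a * sin (w * t) ^ 3" for t
  \<comment> \<open>the constant \<open>2 / (3 w)\<close> makes the primitive vanish at \<open>0\<close> and \<open>1/2\<close>\<close>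
  define G where "G t = a * ((cos (w * t) ^ 3 / 3 - cos (w * t)) / w + 2 / (3 * w))" for t
  define C where "C = w powr (- \<beta>) / (3 * w)"
  have dG: "(G has_real_derivative g t) (at t)" for t
    using DERIV_cmult[OF DERIV_add[OF DERIV_sin_cubed_primitive DERIV_const], of w a] w0
    by (simp add: G_def[abs_def] g_def)
  have GC: "\<bar>G t\<bar> \<le> C" for t
  proof -
    define c where "c = cos (w * t)"
    have c: "-1 \<le> c" "c \<le> 1" by (auto simp: c_def)
    have "c ^ 3 / 3 - c + 2 / 3 = (1 - c)\<^sup>2 * (c + 2) / 3"
      by (simp add: power2_eq_square power3_eq_cube algebra_simps)
    moreover have "4 / 3 - (c ^ 3 / 3 - c + 2 / 3) = (1 + c)\<^sup>2 * (2 - c) / 3"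
      by (simp add: power2_eq_square power3_eq_cube algebra_simps)
    moreover have "0 \<le> (1 - c)\<^sup>2 * (c + 2) / 3" "0 \<le> (1 + c)\<^sup>2 * (2 - c) / 3" using c by auto
    ultimately have "\<bar>c ^ 3 / 3 - c + 2 / 3\<bar> \<le> 4 / 3" by linarith
    then have "a / w * \<bar>c ^ 3 / 3 - c + 2 / 3\<bar> \<le> a / w * (4 / 3)"
      using w0 by (intro mult_left_mono) (auto simp: a_def)
    moreover have "\<bar>G t\<bar> = a / w * \<bar>c ^ 3 / 3 - c + 2 / 3\<bar>"
    proof -
      have "G t = a / w * (c ^ 3 / 3 - c + 2 / 3)" using w0 by (simp add: G_def c_def field_simps)
      then show ?thesis using w0 by (simp add: abs_mult a_def)
    qed
    ultimately show ?thesis by (simp add: a_def C_def)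
  qed
  have w2: "w * (1/2) = 2 * pi * real k" using w by simp
  have sc: "sin (w * (1/2)) = 0" "cos (w * (1/2)) = 1"
    unfolding w2 using sin_npi2[of "2 * k"] cos_2npi[of k] by (simp_all add: mult_ac)
  have G0: "G 0 = 0" "G (1/2) = 0" unfolding G_def sc by (simp_all add: field_simps)
  have cK: "continuous_on {0..1/2} (gamma_kernel b x)"
    by (rule continuous_on_subset[OF continuous_on_gamma_kernel[OF b(1) x0]]) auto
  have cg: "continuous_on {0..1/2} g" unfolding g_def by (intro continuous_intros)
  have cG: "continuous_on {0..1/2} G" unfolding G_def using w0 by (intro continuous_intros) auto
  have "((\<lambda>t. gamma_kernel b x t * g t + gamma_kernel_deriv b x t * G t) has_integral
      (gamma_kernel b x (1/2) * G (1/2) - gamma_kernel b x 0 * G 0)) {0..1/2}"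
  proof (rule fundamental_theorem_of_calculus_interior)
    show "continuous_on {0..1/2} (\<lambda>t. gamma_kernel b x t * G t)" by (intro continuous_intros cK cG)
    show "((\<lambda>t. gamma_kernel b x t * G t) has_vector_derivative
        gamma_kernel b x t * g t + gamma_kernel_deriv b x t * G t) (at t)" if "t \<in> {0<..<1/2}" for t
      using DERIV_mult[OF DERIV_gamma_kernel[OF b(1) x0, of t] dG[of t]] that
      by (simp add: has_real_derivative_iff_has_vector_derivative add.commute mult.commute)
  qed simp
  then have I0: "((\<lambda>t. gamma_kernel b x t * g t + gamma_kernel_deriv b x t * G t) has_integral 0) {0..1/2}"
    using G0 by simp
  have si: "set_integrable lborel {0..1/2} (\<lambda>t. gamma_kernel b x t * g t)"
    by (intro borel_integrable_atLeastAtMost') (intro continuous_intros cK cg)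
  have eq: "(\<lambda>t. gamma_kernel b x t * wiggle \<beta> w t) = (\<lambda>t. indicator {0..1/2} t *\<^sub>R (gamma_kernel b x t * g t))"
  proof
    fix t :: real
    show "gamma_kernel b x t * wiggle \<beta> w t = indicator {0..1/2} t *\<^sub>R (gamma_kernel b x t * g t)"
    proof (cases "t = 1/2")
      case True
      then show ?thesis unfolding True g_def sc by (simp add: wiggle_def)
    qed (auto simp: wiggle_def g_def a_def indicator_def)
  qed
  show "integrable lborel (\<lambda>t. gamma_kernel b x t * wiggle \<beta> w t)"
    unfolding eq using si by (simp add: set_integrable_def)
  have int: "(\<integral>t. gamma_kernel b x t * wiggle \<beta> w t \<partial>lborel) = integral {0..1/2} (\<lambda>t. gamma_kernel b x t * g t)"
    unfolding eq using set_borel_integral_eq_integral(2)[OF si] by (simp add: set_lebesgue_integral_def)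
  have "((\<lambda>t. gamma_kernel b x t * g t) has_integral integral {0..1/2} (\<lambda>t. gamma_kernel b x t * g t)) {0..1/2}"
    using set_borel_integral_eq_integral(1)[OF si] by (rule integrable_integral)
  from has_integral_diff[OF I0 this]
  have I1: "((\<lambda>t. gamma_kernel_deriv b x t * G t) has_integral - integral {0..1/2} (\<lambda>t. gamma_kernel b x t * g t)) {0..1/2}"
    by simp
  have C0: "0 \<le> C" using w0 by (simp add: C_def)
  have Qi: "set_integrable lborel {0..1/2} Q"
    unfolding set_integrable_def using integrable_mult_indicator[of "{0..1/2}" lborel Q] Q(1) by simp
  have "norm (integral {0..1/2} (\<lambda>t. gamma_kernel_deriv b x t * G t)) \<le> integral {0..1/2} (\<lambda>t. Q t * C)"
  proof (rule integral_norm_bound_integral)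
    show "(\<lambda>t. gamma_kernel_deriv b x t * G t) integrable_on {0..1/2}" using I1 by blast
    show "(\<lambda>t. Q t * C) integrable_on {0..1/2}"
      using set_borel_integral_eq_integral(1)[OF Qi] by (rule integrable_on_mult_left)
    show "norm (gamma_kernel_deriv b x t * G t) \<le> Q t * C" for t
      unfolding real_norm_def abs_mult by (intro mult_mono Q GC) auto
  qed
  also have "\<dots> = (LINT t:{0..1/2}|lborel. Q t) * C"
    using set_borel_integral_eq_integral(2)[OF Qi] by simp
  also have "\<dots> \<le> (6 / sqrt b) * C"
  proof (intro mult_right_mono C0)
    have "(LINT t:{0..1/2}|lborel. Q t) \<le> integral\<^sup>L lborel Q"
      unfolding set_lebesgue_integral_def
      using Qi Q by (intro integral_mono) (auto simp: set_integrable_def indicator_def)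
    then show "(LINT t:{0..1/2}|lborel. Q t) \<le> 6 / sqrt b" using Q(2) by linarith
  qed
  also have "\<dots> = 2 * w powr (- \<beta>) / (w * sqrt b)" by (simp add: C_def field_simps)
  finally show "\<bar>\<integral>t. gamma_kernel b x t * wiggle \<beta> w t \<partial>lborel\<bar> \<le> 2 * w powr (- \<beta>) / (w * sqrt b)"
    unfolding int using integral_unique[OF I1] by simp
qed

section \<open>Bias and variance of an iid average\<close>

lemma (in prob_space) powr_expectation_le_nn_integral:
  assumes Z: "integrable M Z" "\<And>x. 0 \<le> Z x" and m: "0 \<le> m" "m \<le> expectation Z" and p: "1 \<le> p"
  shows "ennreal (m powr p) \<le> (\<integral>\<^sup>+x. ennreal (Z x powr p) \<partial>M)"
proof (cases "m = 0")
  case False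
  then have m0: "0 < m" using m by simp
  define h where "h x = m powr p + p * m powr (p - 1) * (Z x - m)" for x
  have h: "integrable M h" unfolding h_def using Z by simp
  have "m powr p \<le> m powr p + p * m powr (p - 1) * (expectation Z - m)" using m p by simp
  also have "\<dots> = expectation h" unfolding h_def using Z by (simp add: prob_space)
  finally have "ennreal (m powr p) \<le> ennreal (expectation h)" by (rule ennreal_leI)
  also have "\<dots> \<le> (\<integral>\<^sup>+x. ennreal (h x) \<partial>M)" by (rule ennreal_integral_le[OF h])
  also have "\<dots> \<le> (\<integral>\<^sup>+x. ennreal (Z x powr p) \<partial>M)"
    unfolding h_def using powr_above_tangent[OF m0 Z(2) p] by (intro nn_integral_mono ennreal_leI)
  finally show ?thesis .
qed simp

lemma expectation_iid_law_prod:
  fixes g :: "nat \<Rightarrow> real \<Rightarrow> real"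
  assumes f: "prob_density f" and g: "\<And>i. integrable (density lborel (\<lambda>x. ennreal (f x))) (g i)"
  shows "integrable (iid_law n f) (\<lambda>X. \<Prod>i\<in>{1..n}. g i (X i))"
    and "(\<integral>X. (\<Prod>i\<in>{1..n}. g i (X i)) \<partial>iid_law n f)
      = (\<Prod>i\<in>{1..n}. \<integral>t. g i t \<partial>density lborel (\<lambda>x. ennreal (f x)))"
proof -
  interpret product_prob_space "\<lambda>_. density lborel (\<lambda>x. ennreal (f x))"
    by (rule product_prob_space_density[OF f])
  show "integrable (iid_law n f) (\<lambda>X. \<Prod>i\<in>{1..n}. g i (X i))"
    unfolding iid_law_def by (rule product_integrable_prod) (use g in auto)
  show "(\<integral>X. (\<Prod>i\<in>{1..n}. g i (X i)) \<partial>iid_law n f)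
      = (\<Prod>i\<in>{1..n}. \<integral>t. g i t \<partial>density lborel (\<lambda>x. ennreal (f x)))"
    unfolding iid_law_def by (rule product_integral_prod) (use g in auto)
qed

text \<open>
  A product of one or two coordinates is written as a product over all coordinates with most factors equal
  to \<open>1\<close>, so that expectations factorise.
\<close>

lemma iid_covariance:
  fixes Z :: "real \<Rightarrow> real"
  assumes f: "prob_density f"
    and Z: "integrable (density lborel (\<lambda>x. ennreal (f x))) Z"
      "integrable (density lborel (\<lambda>x. ennreal (f x))) (\<lambda>t. (Z t)\<^sup>2)"
    and ij: "i \<in> {1..n}" "j \<in> {1..n}"
  shows "integrable (iid_law n f) (\<lambda>X. Z (X i))"
    and "(\<integral>X. Z (X i) \<partial>iid_law n f) = (\<integral>t. Z t \<partial>density lborel (\<lambda>x. ennreal (f x)))"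
    and "integrable (iid_law n f) (\<lambda>X. Z (X i) * Z (X j))"
    and "(\<integral>t. Z t \<partial>density lborel (\<lambda>x. ennreal (f x))) = 0 \<Longrightarrow>
      (\<integral>X. Z (X i) * Z (X j) \<partial>iid_law n f)
      = (if i = j then (\<integral>t. (Z t)\<^sup>2 \<partial>density lborel (\<lambda>x. ennreal (f x))) else 0)"
proof -
  define M where "M = density lborel (\<lambda>x. ennreal (f x))"
  interpret M: prob_space M unfolding M_def by (rule prob_space_density[OF f])
  note Z = Z[folded M_def]
  note P = expectation_iid_law_prod[OF f, folded M_def, of _ n]
  define g1 where "g1 k t = (if k = i then Z t else 1)" for k t
  have g1: "integrable M (g1 k)" for k unfolding g1_def using Z by (cases "k = i") auto
  have e1: "(\<Prod>k\<in>{1..n}. g1 k (X k)) = Z (X i)" for X using ij by (simp add: g1_def prod.delta)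
  have m1: "(\<integral>t. g1 k t \<partial>M) = (if k = i then (\<integral>t. Z t \<partial>M) else 1)" for k
    unfolding g1_def by (simp add: M.prob_space)
  show "integrable (iid_law n f) (\<lambda>X. Z (X i))" using P(1)[of g1, OF g1] by (simp only: e1)
  have "(\<integral>X. Z (X i) \<partial>iid_law n f) = (\<Prod>k\<in>{1..n}. if k = i then (\<integral>t. Z t \<partial>M) else 1)"
    using P(2)[of g1, OF g1] by (simp only: e1 m1)
  also have "\<dots> = (\<integral>t. Z t \<partial>M)" using ij by (simp add: prod.delta)
  finally show "(\<integral>X. Z (X i) \<partial>iid_law n f) = (\<integral>t. Z t \<partial>density lborel (\<lambda>x. ennreal (f x)))"
    by (simp add: M_def)
  define g2 where "g2 k t = (if k = i then Z t else 1) * (if k = j then Z t else 1)" for k t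
  have g2: "integrable M (g2 k)" for k
    unfolding g2_def using Z by (cases "k = i"; cases "k = j") (auto simp: power2_eq_square)
  have e2: "(\<Prod>k\<in>{1..n}. g2 k (X k)) = Z (X i) * Z (X j)" for X
    using ij by (simp add: g2_def prod.distrib prod.delta)
  show "integrable (iid_law n f) (\<lambda>X. Z (X i) * Z (X j))" using P(1)[of g2, OF g2] by (simp only: e2)
  assume "(\<integral>t. Z t \<partial>density lborel (\<lambda>x. ennreal (f x))) = 0"
  then have Z0: "(\<integral>t. Z t \<partial>M) = 0" by (simp add: M_def)
  have "(\<integral>X. Z (X i) * Z (X j) \<partial>iid_law n f) = (\<Prod>k\<in>{1..n}. \<integral>t. g2 k t \<partial>M)"
    using P(2)[of g2, OF g2] by (simp only: e2)
  also have "\<dots> = (if i = j then (\<integral>t. (Z t)\<^sup>2 \<partial>M) else 0)"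
  proof (cases "i = j")
    case True
    have "(\<integral>t. g2 k t \<partial>M) = (if k = i then (\<integral>t. (Z t)\<^sup>2 \<partial>M) else 1)" for k
      using True by (simp add: g2_def M.prob_space power2_eq_square)
    then show ?thesis using True ij by (simp add: prod.delta)
  next
    case False
    have "(\<integral>t. g2 i t \<partial>M) = 0" using False Z0 by (simp add: g2_def)
    then show ?thesis using False ij by (auto intro!: prod_zero)
  qed
  finally show "(\<integral>X. Z (X i) * Z (X j) \<partial>iid_law n f)
      = (if i = j then (\<integral>t. (Z t)\<^sup>2 \<partial>density lborel (\<lambda>x. ennreal (f x))) else 0)"
    by (simp add: M_def)
qed

lemma iid_average_moments:
  fixes Y :: "real \<Rightarrow> real"
  assumes f: "prob_density f" and Y: "integrable (density lborel (\<lambda>x. ennreal (f x))) Y"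
      "integrable (density lborel (\<lambda>x. ennreal (f x))) (\<lambda>t. (Y t)\<^sup>2)" and n: "0 < n"
  defines "\<mu> \<equiv> \<integral>t. Y t \<partial>density lborel (\<lambda>x. ennreal (f x))"
    and "\<mu>2 \<equiv> \<integral>t. (Y t)\<^sup>2 \<partial>density lborel (\<lambda>x. ennreal (f x))"
  shows "integrable (iid_law n f) (\<lambda>X. (1 / real n) * (\<Sum>i = 1..n. Y (X i)) - c)"
    and "(\<integral>X. (1 / real n) * (\<Sum>i = 1..n. Y (X i)) - c \<partial>iid_law n f) = \<mu> - c"
    and "integrable (iid_law n f) (\<lambda>X. ((1 / real n) * (\<Sum>i = 1..n. Y (X i)) - c)\<^sup>2)"
    and "(\<mu>2 - \<mu>\<^sup>2) / real n \<le> (\<integral>X. ((1 / real n) * (\<Sum>i = 1..n. Y (X i)) - c)\<^sup>2 \<partial>iid_law n f)"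
proof -
  define M where "M = density lborel (\<lambda>x. ennreal (f x))"
  interpret M: prob_space M unfolding M_def by (rule prob_space_density[OF f])
  interpret P: prob_space "iid_law n f" by (rule prob_space_iid_law[OF f])
  note YM = Y[folded M_def]
  define S where "S X = (1 / real n) * (\<Sum>i = 1..n. Y (X i))" for X :: "nat \<Rightarrow> real"
  define Z where "Z t = Y t - \<mu>" for t
  have mu: "\<mu> = M.expectation Y" "\<mu>2 = M.expectation (\<lambda>t. (Y t)\<^sup>2)" by (auto simp: \<mu>_def \<mu>2_def M_def)
  have Zi: "integrable M Z" "integrable M (\<lambda>t. (Z t)\<^sup>2)"
    unfolding Z_def using YM by (simp_all add: power2_diff)
  have Z0: "M.expectation Z = 0" unfolding Z_def using YM by (simp add: mu M.prob_space)
  have Z2: "M.expectation (\<lambda>t. (Z t)\<^sup>2) = \<mu>2 - \<mu>\<^sup>2"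
    unfolding Z_def mu using M.variance_eq[OF YM] by simp
  note C = iid_covariance[OF f Zi[unfolded M_def], of _ n]
  define U where "U X = (1 / real n) * (\<Sum>i = 1..n. Z (X i))" for X :: "nat \<Rightarrow> real"
  have SU: "S X - c = (\<mu> - c) + U X" for X
    using n by (simp add: S_def U_def Z_def sum_subtractf field_simps)
  have Ui: "integrable (iid_law n f) U"
    unfolding U_def using C(1) by (intro integrable_mult_right Bochner_Integration.integrable_sum) auto
  have U0: "P.expectation U = 0"
  proof -
    have "P.expectation U = (1 / real n) * (\<Sum>i = 1..n. P.expectation (\<lambda>X. Z (X i)))"
      unfolding U_def using C(1) by (simp add: Bochner_Integration.integral_sum)
    also have "(\<Sum>i = 1..n. P.expectation (\<lambda>X. Z (X i))) = (\<Sum>i = 1..n. 0)"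
      using C(2) Z0 by (intro sum.cong) (auto simp: M_def)
    finally show ?thesis by simp
  qed
  have U2: "(U X)\<^sup>2 = (1 / (real n)\<^sup>2) * (\<Sum>i = 1..n. \<Sum>j = 1..n. Z (X i) * Z (X j))" for X
    by (simp add: U_def power_mult_distrib power_divide power2_eq_square sum_product)
  have U2i: "integrable (iid_law n f) (\<lambda>X. (U X)\<^sup>2)"
    unfolding U2 using C(3) by (intro integrable_mult_right Bochner_Integration.integrable_sum) auto
  have EU2: "P.expectation (\<lambda>X. (U X)\<^sup>2) = (\<mu>2 - \<mu>\<^sup>2) / real n"
  proof -
    have "P.expectation (\<lambda>X. (U X)\<^sup>2)
        = (1 / (real n)\<^sup>2) * P.expectation (\<lambda>X. \<Sum>i = 1..n. \<Sum>j = 1..n. Z (X i) * Z (X j))"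
      unfolding U2 by simp
    also have "P.expectation (\<lambda>X. \<Sum>i = 1..n. \<Sum>j = 1..n. Z (X i) * Z (X j))
        = (\<Sum>i = 1..n. P.expectation (\<lambda>X. \<Sum>j = 1..n. Z (X i) * Z (X j)))"
      by (intro Bochner_Integration.integral_sum Bochner_Integration.integrable_sum C(3))
    also have "\<dots> = (\<Sum>i = 1..n. \<Sum>j = 1..n. P.expectation (\<lambda>X. Z (X i) * Z (X j)))"
      by (intro sum.cong refl Bochner_Integration.integral_sum C(3))
    also have "(\<Sum>i = 1..n. \<Sum>j = 1..n. P.expectation (\<lambda>X. Z (X i) * Z (X j)))
        = (\<Sum>i = 1..n. \<Sum>j = 1..n. if i = j then \<mu>2 - \<mu>\<^sup>2 else 0)"
      using C(4) Z0 Z2 by (intro sum.cong) (auto simp: M_def)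
    also have "\<dots> = real n * (\<mu>2 - \<mu>\<^sup>2)" by (simp add: sum.delta)
    finally show ?thesis using n by (simp add: power2_eq_square)
  qed
  have "integrable (iid_law n f) (\<lambda>X. S X - c)" unfolding SU using Ui by simp
  then show "integrable (iid_law n f) (\<lambda>X. (1 / real n) * (\<Sum>i = 1..n. Y (X i)) - c)"
    by (simp add: S_def)
  have "P.expectation (\<lambda>X. S X - c) = \<mu> - c" unfolding SU using Ui U0 by (simp add: P.prob_space)
  then show "(\<integral>X. (1 / real n) * (\<Sum>i = 1..n. Y (X i)) - c \<partial>iid_law n f) = \<mu> - c"
    by (simp add: S_def)
  \<comment> \<open>the square splits into bias and variance; only the variance is kept\<close>
  have sq: "(S X - c)\<^sup>2 = (\<mu> - c)\<^sup>2 + 2 * (\<mu> - c) * U X + (U X)\<^sup>2" for X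
    unfolding SU by (rule power2_sum[THEN trans]) simp
  have "integrable (iid_law n f) (\<lambda>X. (S X - c)\<^sup>2)" unfolding sq using Ui U2i by simp
  then show "integrable (iid_law n f) (\<lambda>X. ((1 / real n) * (\<Sum>i = 1..n. Y (X i)) - c)\<^sup>2)"
    by (simp add: S_def)
  have "P.expectation (\<lambda>X. (S X - c)\<^sup>2) = (\<mu> - c)\<^sup>2 + (\<mu>2 - \<mu>\<^sup>2) / real n"
    unfolding sq using Ui U2i U0 EU2 by (simp add: P.prob_space)
  then have "(\<mu>2 - \<mu>\<^sup>2) / real n \<le> P.expectation (\<lambda>X. (S X - c)\<^sup>2)" by simp
  then show "(\<mu>2 - \<mu>\<^sup>2) / real n \<le> (\<integral>X. ((1 / real n) * (\<Sum>i = 1..n. Y (X i)) - c)\<^sup>2 \<partial>iid_law n f)"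
    by (simp add: S_def)
qed

section \<open>Lower bounds for the gamma kernel estimator\<close>

lemma measurable_Gamma_real [measurable]: "(Gamma :: real \<Rightarrow> real) \<in> borel_measurable borel"
proof -
  have "(rGamma :: real \<Rightarrow> real) \<in> borel_measurable borel"
    by (intro borel_measurable_continuous_onI continuous_on_rGamma)
  then have "(\<lambda>x. inverse (rGamma x) :: real) \<in> borel_measurable borel" by measurable
  then show ?thesis by (simp add: rGamma_inverse_Gamma)
qed

lemma gamma_kde_in_estimators: "gamma_kde n b \<in> estimators n"
  unfolding estimators_def gamma_kde_def gamma_kernel_def case_prod_beta mem_Collect_eq by measurable

lemma measurable_gamma_kernel [measurable]: "gamma_kernel b x \<in> borel_measurable borel"
  unfolding gamma_kernel_def by measurable

lemma gamma_kernel_bounded: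
  assumes b: "0 < b" and x: "0 < x"
  obtains B where "\<And>t. \<bar>gamma_kernel b x t\<bar> \<le> B"
proof -
  define a where "a = x / b"
  have a: "0 < a" using b x by (simp add: a_def)
  define N where "N = b powr (a + 1) * Gamma (a + 1)"
  have N: "0 < N" unfolding N_def using a b by (intro mult_pos_pos Gamma_real_pos) auto
  have "\<bar>gamma_kernel b x t\<bar> \<le> (b powr a * a powr a) / N" for t
  proof (cases "0 \<le> t")
    case True
    have "t powr a * exp (- t / b) = b powr a * ((t / b) powr a * exp (- t / b))"
      using True b by (simp add: powr_divide)
    also have "(t / b) powr a * exp (- t / b) \<le> (a powr a * exp (t / b)) * exp (- t / b)"
      using True b a by (intro mult_right_mono powr_le_exp) auto
    also have "\<dots> = a powr a" by (simp add: exp_minus)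
    finally have "t powr a * exp (- t / b) \<le> b powr a * a powr a" by (simp add: mult_left_mono)
    then have "t powr a * exp (- t / b) / N \<le> (b powr a * a powr a) / N"
      using N by (intro divide_right_mono) auto
    moreover have "gamma_kernel b x t = t powr a * exp (- t / b) / N"
      using True x by (simp add: gamma_kernel_def N_def a_def)
    ultimately show ?thesis using gamma_kernel_nonneg[of b x t] b x by simp
  qed (use N in simp)
  then show ?thesis using that by blast
qed

lemma gamma_kernel_integrable_density:
  assumes b: "0 < b" and x: "0 < x" and f: "prob_density f"
  shows "integrable (density lborel (\<lambda>x. ennreal (f x))) (gamma_kernel b x)"
    and "integrable (density lborel (\<lambda>x. ennreal (f x))) (\<lambda>t. (gamma_kernel b x t)\<^sup>2)"
    and "integrable lborel (\<lambda>t. gamma_kernel b x t * f t)"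
    and "integrable lborel (\<lambda>t. (gamma_kernel b x t)\<^sup>2 * f t)"
    and "(\<integral>t. gamma_kernel b x t \<partial>density lborel (\<lambda>x. ennreal (f x))) = (\<integral>t. gamma_kernel b x t * f t \<partial>lborel)"
    and "(\<integral>t. (gamma_kernel b x t)\<^sup>2 \<partial>density lborel (\<lambda>x. ennreal (f x))) = (\<integral>t. (gamma_kernel b x t)\<^sup>2 * f t \<partial>lborel)"
proof -
  have [measurable]: "f \<in> borel_measurable borel" and f0: "\<And>x. 0 \<le> f x"
    using f by (auto simp: prob_density_def)
  interpret M: prob_space "density lborel (\<lambda>x. ennreal (f x))" by (rule prob_space_density[OF f])
  obtain B where B: "\<And>t. \<bar>gamma_kernel b x t\<bar> \<le> B" using gamma_kernel_bounded[OF b x] by blast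
  have B2: "(gamma_kernel b x t)\<^sup>2 \<le> B\<^sup>2" for t using power_mono[OF B[of t], of 2] by simp
  show i: "integrable (density lborel (\<lambda>x. ennreal (f x))) (gamma_kernel b x)"
    by (rule M.integrable_const_bound[of _ B]) (use B in auto)
  show i2: "integrable (density lborel (\<lambda>x. ennreal (f x))) (\<lambda>t. (gamma_kernel b x t)\<^sup>2)"
    by (rule M.integrable_const_bound[of _ "B\<^sup>2"]) (use B2 in auto)
  show "integrable lborel (\<lambda>t. gamma_kernel b x t * f t)"
    using i f0 by (subst (asm) integrable_density) (auto simp: mult.commute)
  show "integrable lborel (\<lambda>t. (gamma_kernel b x t)\<^sup>2 * f t)"
    using i2 f0 by (subst (asm) integrable_density) (auto simp: mult.commute)
  show "(\<integral>t. gamma_kernel b x t \<partial>density lborel (\<lambda>x. ennreal (f x))) = (\<integral>t. gamma_kernel b x t * f t \<partial>lborel)"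
    using f0 by (subst integral_density) (auto simp: mult.commute)
  show "(\<integral>t. (gamma_kernel b x t)\<^sup>2 \<partial>density lborel (\<lambda>x. ennreal (f x))) = (\<integral>t. (gamma_kernel b x t)\<^sup>2 * f t \<partial>lborel)"
    using f0 by (subst integral_density) (auto simp: mult.commute)
qed

lemma pointwise_risk_gamma_kde_ge_bias:
  assumes b: "0 < b" and x: "0 < x" and f: "prob_density f" and n: "0 < n" and p: "1 \<le> p"
  shows "ennreal (\<bar>(\<integral>t. gamma_kernel b x t * f t \<partial>lborel) - f x\<bar> powr p) \<le> pointwise_risk p n (gamma_kde n b) f x"
proof -
  interpret P: prob_space "iid_law n f" by (rule prob_space_iid_law[OF f])
  note K = gamma_kernel_integrable_density[OF b x f]
  note A = iid_average_moments[OF f K(1,2) n, of "f x", folded gamma_kde_def, unfolded K(5,6)]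
  show ?thesis unfolding pointwise_risk_def
  proof (rule P.powr_expectation_le_nn_integral)
    show "integrable (iid_law n f) (\<lambda>X. \<bar>gamma_kde n b X x - f x\<bar>)" using A(1) by (rule integrable_abs)
    show "\<bar>(\<integral>t. gamma_kernel b x t * f t \<partial>lborel) - f x\<bar> \<le> P.expectation (\<lambda>X. \<bar>gamma_kde n b X x - f x\<bar>)"
      unfolding A(2)[symmetric] by (rule integral_abs_bound)
  qed (use p in auto)
qed

lemma pointwise_risk_gamma_kde_ge_variance:
  assumes b: "0 < b" and x: "0 < x" and f: "prob_density f" and n: "0 < n" and p: "2 \<le> p"
    and v: "0 \<le> v" "v \<le> ((\<integral>t. (gamma_kernel b x t)\<^sup>2 * f t \<partial>lborel) - (\<integral>t. gamma_kernel b x t * f t \<partial>lborel)\<^sup>2) / real n"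
  shows "ennreal (v powr (p / 2)) \<le> pointwise_risk p n (gamma_kde n b) f x"
proof -
  interpret P: prob_space "iid_law n f" by (rule prob_space_iid_law[OF f])
  note K = gamma_kernel_integrable_density[OF b x f]
  note A = iid_average_moments[OF f K(1,2) n, of "f x", folded gamma_kde_def, unfolded K(5,6)]
  have "ennreal (v powr (p / 2)) \<le> (\<integral>\<^sup>+X. ennreal ((gamma_kde n b X x - f x)\<^sup>2 powr (p / 2)) \<partial>iid_law n f)"
  proof (rule P.powr_expectation_le_nn_integral[OF A(3)])
    show "v \<le> P.expectation (\<lambda>X. (gamma_kde n b X x - f x)\<^sup>2)" using v(2) A(4) by linarith
  qed (use p v in auto)
  also have "\<dots> = pointwise_risk p n (gamma_kde n b) f x"
  proof -
    have "y\<^sup>2 powr (p / 2) = \<bar>y\<bar> powr p" for y :: real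
    proof (cases "y = 0")
      case False
      have "y\<^sup>2 = \<bar>y\<bar> powr 2" using False by (simp add: powr_numeral)
      then show ?thesis by (simp only: powr_powr) simp
    qed simp
    then show ?thesis by (simp add: pointwise_risk_def)
  qed
  finally show ?thesis .
qed

text \<open>
  The frequency \<open>w\<close> is a multiple of \<open>4 \<pi>\<close> between \<open>32 / sqrt b\<close> and \<open>48 / sqrt b\<close>. From
  \<open>32 / sqrt b\<close> on, the kernel leaves at most a quarter of the amplitude of the wiggle, so the
  biases at the two densities differ by a fixed part of the wiggle itself.
\<close>

lemma gamma_kde_bias_lower_bound:
  assumes p: "1 \<le> p" and \<beta>: "0 < \<beta>" "\<beta> \<le> 2" and n: "0 < n" and b: "0 < b" "b < 1"
  shows "ennreal (48 powr (- \<beta>) / 512 * b powr (\<beta> / 2)) \<le> max_risk p n (gamma_kde n b) (holder_class \<beta> 54)"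
proof -
  define r where "r = 32 / sqrt b"
  have sb: "0 < sqrt b" "sqrt b < 1" using b by auto
  have r: "0 < r" using sb by (simp add: r_def)
  define k where "k = nat \<lceil>r / (4 * pi)\<rceil>"
  have kpos: "0 < r / (4 * pi)" using r by simp
  then have k0: "0 < k" by (simp add: k_def)
  have k: "r / (4 * pi) \<le> real k" "real k < r / (4 * pi) + 1" using kpos by (auto simp: k_def) linarith
  define w where "w = 4 * pi * real k"
  have w: "w = 4 * pi * real k" "0 < k" by (fact w_def, fact k0)
  have w1: "1 \<le> w" by (rule frequency_facts[OF w])
  have wr: "r \<le> w" using k(1) by (simp add: w_def field_simps)
  have wu: "w \<le> 48 / sqrt b"
  proof -
    have "w < r + 4 * pi" using k(2) by (simp add: w_def field_simps)
    moreover have "4 * pi \<le> 16 * 1" using pi_less_4 by simp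
    moreover have "16 * 1 \<le> 16 / sqrt b"
      unfolding pos_le_divide_eq[OF sb(1)] using sb(2) by linarith
    ultimately show ?thesis by (simp add: r_def)
  qed
  define \<kappa> where "\<kappa> = w powr (- \<beta>) / 8"
  have \<kappa>: "0 \<le> \<kappa>" by (simp add: \<kappa>_def)
  have f: "prob_density base_density" "prob_density (perturbed_density \<beta> w)"
    using prob_density_base_density prob_density_perturbed_density[OF _ w] \<beta> by auto
  have "ennreal (\<kappa> / 64) \<le> max_risk p n (gamma_kde n b) (holder_class \<beta> 54)"
  proof (rule max_risk_ge_of_sine_separation[OF gamma_kde_in_estimators p \<beta> w \<kappa>])
    fix x :: real assume x: "1/4 \<le> x" "x \<le> 1/2"
    have x0: "0 < x" using x by simp
    define B0 where "B0 = (\<integral>t. gamma_kernel b x t * base_density t \<partial>lborel) - base_density x"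
    define B1 where "B1 = (\<integral>t. gamma_kernel b x t * perturbed_density \<beta> w t \<partial>lborel) - perturbed_density \<beta> w x"
    define I where "I = (\<integral>t. gamma_kernel b x t * wiggle \<beta> w t \<partial>lborel)"
    note W = gamma_kernel_smooths_wiggle[OF b x w, of \<beta>]
    have diff: "B1 - B0 = I - wiggle \<beta> w x"
      unfolding B1_def B0_def I_def perturbed_density_def distrib_left
      using gamma_kernel_integrable_density(3)[OF b(1) x0 f(1)] W(1) by simp
    have "\<bar>I\<bar> \<le> \<kappa> / 2"
    proof -
      have "32 \<le> w * sqrt b" using wr sb by (simp add: r_def field_simps)
      then have "2 * w powr (- \<beta>) / (w * sqrt b) \<le> 2 * w powr (- \<beta>) / 32"
        by (intro divide_left_mono) (use w1 sb in auto)
      then show ?thesis using W(2) by (simp add: I_def \<kappa>_def)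
    qed
    moreover have "\<bar>wiggle \<beta> w x\<bar> = 2 * \<kappa> * \<bar>sin (w * x)\<bar> ^ 3"
    proof (cases "x = 1/2")
      case True
      have "sin (w * (1/2)) = 0" using frequency_facts(2)[OF w] by simp
      then show ?thesis unfolding True by (simp add: wiggle_def)
    next
      case False
      then show ?thesis using x by (simp add: wiggle_def \<kappa>_def abs_mult power_abs)
    qed
    ultimately have "\<kappa> * (\<bar>sin (w * x)\<bar> ^ 3 - 1/4) \<le> \<bar>B1 - B0\<bar> / 2"
      unfolding diff by (simp add: algebra_simps abs_le_iff)
    then have "\<kappa> * max 0 (\<bar>sin (w * x)\<bar> ^ 3 - 1/4) \<le> \<bar>B1 - B0\<bar> / 2"
      by (auto simp: max_def)
    then have "(\<kappa> * max 0 (\<bar>sin (w * x)\<bar> ^ 3 - 1/4)) powr p \<le> (\<bar>B1 - B0\<bar> / 2) powr p"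
      using \<kappa> p by (intro powr_mono2) auto
    also have "\<dots> \<le> \<bar>B1\<bar> powr p + \<bar>B0\<bar> powr p" using p by (intro half_diff_powr_le) auto
    finally have "\<kappa> powr p * max 0 (\<bar>sin (w * x)\<bar> ^ 3 - 1/4) powr p \<le> \<bar>B0\<bar> powr p + \<bar>B1\<bar> powr p"
      using \<kappa> by (simp add: powr_mult)
    then have "ennreal (\<kappa> powr p * max 0 (\<bar>sin (w * x)\<bar> ^ 3 - 1/4) powr p)
      \<le> ennreal (\<bar>B0\<bar> powr p) + ennreal (\<bar>B1\<bar> powr p)"
      by (simp add: ennreal_plus[symmetric] ennreal_leI del: ennreal_plus)
    also have "\<dots> \<le> pointwise_risk p n (gamma_kde n b) base_density x
        + pointwise_risk p n (gamma_kde n b) (perturbed_density \<beta> w) x"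
      unfolding B0_def B1_def
      by (intro add_mono pointwise_risk_gamma_kde_ge_bias b x0 f n p)
    finally show "ennreal (\<kappa> powr p * max 0 (\<bar>sin (w * x)\<bar> ^ 3 - 1/4) powr p)
      \<le> pointwise_risk p n (gamma_kde n b) base_density x
        + pointwise_risk p n (gamma_kde n b) (perturbed_density \<beta> w) x" .
  qed
  moreover have "48 powr (- \<beta>) / 512 * b powr (\<beta> / 2) \<le> \<kappa> / 64"
  proof -
    have "b powr (\<beta> / 2) = (sqrt b) powr \<beta>" using b by (simp add: powr_half_sqrt[symmetric] powr_powr)
    then have "48 powr (- \<beta>) * b powr (\<beta> / 2) = (48 / sqrt b) powr (- \<beta>)"
      unfolding powr_divide powr_minus_divide[of "sqrt b"] by simp
    also have "\<dots> \<le> w powr (- \<beta>)" using w1 wu \<beta> by (intro powr_mono2') auto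
    finally show ?thesis by (simp add: \<kappa>_def)
  qed
  ultimately show ?thesis by (meson ennreal_leI order_trans)
qed

text \<open>
  By Chebyshev's inequality most of the mass of the kernel lies within \<open>3 sqrt (b x)\<close> of \<open>x\<close>, and a
  density concentrated on an interval of length \<open>l\<close> has squared integral at least of order
  \<open>1 / l\<close>. Both steps are combined in one pointwise bound: \<open>K\<^sup>2 \<ge> 2 m K - m\<^sup>2\<close> on the interval, and the
  indicator of the interval is at least \<open>1 - (t - x)\<^sup>2 / (9 b x)\<close>.
\<close>

lemma gamma_kernel_square_integral_ge:
  assumes b: "0 < b" and x: "b \<le> x" "x \<le> 1/8"
  shows "1 / (27 * sqrt (b * x)) \<le> (\<integral>t. (gamma_kernel b x t)\<^sup>2 * base_density t \<partial>lborel)"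
proof -
  have x0: "0 < x" using b x by simp
  define q where "q = sqrt (b * x)"
  have q: "0 < q" "q\<^sup>2 = b * x" using b x0 by (auto simp: q_def)
  have qx: "q \<le> x" unfolding q_def using b x x0 by (intro real_le_lsqrt) (auto simp: power2_eq_square)
  \<comment> \<open>the maximiser of \<open>2/3 m - 3 q m\<^sup>2\<close>, the lower bound obtained for the integral\<close>
  define m where "m = 1 / (9 * q)"
  have m: "0 < m" using q by (simp add: m_def)
  define K where "K = gamma_kernel b x"
  have K: "0 \<le> K t" for t using gamma_kernel_nonneg[of b x t] b x0 by (simp add: K_def)
  define h where "h t = m * K t - m / (9 * q\<^sup>2) * (K t * (t - x)\<^sup>2)
    - m\<^sup>2 / 2 * indicator {x - 3 * q..x + 3 * q} t" for t
  have "has_bochner_integral lborel (indicator {x - 3 * q..x + 3 * q} :: real \<Rightarrow> real) (6 * q)"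
    using q by (auto simp: has_bochner_integral_iff emeasure_lborel_Icc_eq)
  then have h: "has_bochner_integral lborel h (m * 1 - m / (9 * q\<^sup>2) * (b * x + 2 * b\<^sup>2) - m\<^sup>2 / 2 * (6 * q))"
    unfolding h_def K_def
    by (intro has_bochner_integral_diff has_bochner_integral_mult_right
        gamma_kernel_moments(1)[OF b x0] has_bochner_integral_gamma_kernel_variance[OF b x0])
  have hle: "h t \<le> (K t)\<^sup>2 * base_density t" for t
  proof (cases "t \<in> {x - 3 * q..x + 3 * q}")
    case True
    show ?thesis
    proof (cases "0 \<le> t")
      case t0: True
      have "1/2 \<le> base_density t" using True t0 qx x by (intro base_density_ge) auto
      then have "(K t)\<^sup>2 * (1/2) \<le> (K t)\<^sup>2 * base_density t" by (intro mult_left_mono) auto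
      moreover have "m * K t - m\<^sup>2 / 2 \<le> (K t)\<^sup>2 * (1/2)"
      proof -
        have "0 \<le> (K t - m)\<^sup>2" by simp
        then show ?thesis by (simp add: power2_diff algebra_simps)
      qed
      moreover have "h t \<le> m * K t - m\<^sup>2 / 2"
      proof -
        have "0 \<le> m / (9 * q\<^sup>2) * (K t * (t - x)\<^sup>2)"
          using m K[of t] by (intro mult_nonneg_nonneg) auto
        then show ?thesis using True by (simp add: h_def)
      qed
      ultimately show ?thesis by linarith
    next
      case False
      then show ?thesis by (simp add: h_def K_def True)
    qed
  next
    case False
    then have "3 * q \<le> \<bar>t - x\<bar>" using q by (auto simp: abs_if)
    then have "(3 * q)\<^sup>2 \<le> \<bar>t - x\<bar>\<^sup>2" using q by (intro power_mono) auto
    then have "9 * q\<^sup>2 \<le> (t - x)\<^sup>2" by (simp add: power_mult_distrib)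
    then have "m * K t / (9 * q\<^sup>2) * (9 * q\<^sup>2) \<le> m * K t / (9 * q\<^sup>2) * (t - x)\<^sup>2"
      using m K[of t] by (intro mult_left_mono) auto
    moreover have "m * K t / (9 * q\<^sup>2) * (9 * q\<^sup>2) = m * K t" using q(1) by simp
    moreover have "m * K t / (9 * q\<^sup>2) * (t - x)\<^sup>2 = m / (9 * q\<^sup>2) * (K t * (t - x)\<^sup>2)" by simp
    ultimately have "m * K t \<le> m / (9 * q\<^sup>2) * (K t * (t - x)\<^sup>2)" by (simp only:)
    moreover have "h t = m * K t - m / (9 * q\<^sup>2) * (K t * (t - x)\<^sup>2)" using False by (simp add: h_def)
    ultimately have "h t \<le> 0" by linarith
    also have "0 \<le> (K t)\<^sup>2 * base_density t" by (simp add: base_density_nonneg)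
    finally show ?thesis .
  qed
  have "1 / (27 * q) \<le> m * 1 - m / (9 * q\<^sup>2) * (b * x + 2 * b\<^sup>2) - m\<^sup>2 / 2 * (6 * q)"
  proof -
    have "b * b \<le> b * x" using b x by simp
    then have "b * x + 2 * b\<^sup>2 \<le> 3 * q\<^sup>2" unfolding q by (simp add: power2_eq_square)
    then have "m / (9 * q\<^sup>2) * (b * x + 2 * b\<^sup>2) \<le> m / (9 * q\<^sup>2) * (3 * q\<^sup>2)"
      using m by (intro mult_left_mono) auto
    also have "\<dots> = m / 3" using q(1) by simp
    finally have "m * 1 - m / 3 - m\<^sup>2 / 2 * (6 * q) \<le> m * 1 - m / (9 * q\<^sup>2) * (b * x + 2 * b\<^sup>2) - m\<^sup>2 / 2 * (6 * q)"
      by simp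
    moreover have "m * 1 - m / 3 - m\<^sup>2 / 2 * (6 * q) = 1 / (27 * q)"
      using q(1) by (simp add: m_def power2_eq_square field_simps)
    ultimately show ?thesis by linarith
  qed
  also have "\<dots> = integral\<^sup>L lborel h" using has_bochner_integral_integral_eq[OF h] by simp
  also have "\<dots> \<le> (\<integral>t. (K t)\<^sup>2 * base_density t \<partial>lborel)"
  proof (rule integral_mono)
    show "integrable lborel h" using h by (simp add: has_bochner_integral_iff)
    show "integrable lborel (\<lambda>t. (K t)\<^sup>2 * base_density t)"
      unfolding K_def by (rule gamma_kernel_integrable_density(4)[OF b x0 prob_density_base_density])
  qed (rule hle)
  finally show ?thesis by (simp add: K_def q_def)
qed

text \<open>
  For \<open>p \<ge> 4\<close> and \<open>x \<le> 1\<close> the \<open>p/2\<close>-th power of \<open>1 / sqrt x\<close> is at least \<open>1 / x\<close>, whose integral over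
  \<open>[b,1/8]\<close> is the logarithm. For \<open>b \<le> 1 / 10^6\<close> the squared mean of the kernel, at most \<open>16\<close>, is
  dominated by half of the lower bound for its mean square.
\<close>

lemma gamma_kde_variance_lower_bound:
  assumes p: "4 \<le> p" and \<beta>: "0 < \<beta>" "\<beta> \<le> 2" and n: "0 < n" and b: "0 < b" "b \<le> 1 / 10 ^ 6"
  shows "ennreal ((54 * real n * sqrt b) powr (- 1 / 2) * ln (1 / (8 * b)) powr (1 / p))
    \<le> max_risk p n (gamma_kde n b) (holder_class \<beta> 54)"
proof (rule max_risk_lower_bound[OF gamma_kde_in_estimators base_density_in_holder_class[OF \<beta>] prob_density_base_density])
  define c where "c = (54 * real n * sqrt b) powr (- p / 2)"
  have b8: "b \<le> 1/8" using b by simp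
  have ln0: "0 \<le> ln (1 / (8 * b))" using b b8 by (intro ln_ge_zero) (auto simp: field_simps)
  have e: "((54 * real n * sqrt b) powr (- 1 / 2) * ln (1 / (8 * b)) powr (1 / p)) powr p = c * ln (1 / (8 * b))"
    using p ln0 by (simp add: powr_mult powr_powr c_def)
  have pt: "ennreal (c * (1 / x)) \<le> pointwise_risk p n (gamma_kde n b) base_density x" if x: "b \<le> x" "x \<le> 1/8" for x
  proof -
    have x0: "0 < x" using b x by simp
    define q where "q = sqrt (b * x)"
    have q0: "0 < q" using b x0 by (simp add: q_def)
    have q1: "q \<le> 1 / 864"
    proof -
      have "b * x \<le> 1 / 10 ^ 6 * (1 / 8)" using b x x0 by (intro mult_mono) auto
      also have "\<dots> \<le> (1 / 864)\<^sup>2" by (simp add: power2_eq_square)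
      finally show ?thesis unfolding q_def by (intro real_le_lsqrt) auto
    qed
    define m where "m = (\<integral>t. gamma_kernel b x t * base_density t \<partial>lborel)"
    have m: "0 \<le> m" "m \<le> 4"
    proof -
      have K: "0 \<le> gamma_kernel b x t" for t using gamma_kernel_nonneg[of b x t] b x0 by simp
      show "0 \<le> m" unfolding m_def by (rule integral_nonneg_AE) (simp add: K base_density_nonneg)
      have Ki: "has_bochner_integral lborel (gamma_kernel b x) 1" by (rule gamma_kernel_moments(1)[OF b(1) x0])
      have "m \<le> (\<integral>t. gamma_kernel b x t * 4 \<partial>lborel)"
        unfolding m_def
        using gamma_kernel_integrable_density(3)[OF b(1) x0 prob_density_base_density] Ki
        by (intro integral_mono mult_left_mono base_density_le K) (auto simp: has_bochner_integral_iff)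
      also have "\<dots> = 4" using has_bochner_integral_integral_eq[OF Ki] by simp
      finally show "m \<le> 4" .
    qed
    have "m\<^sup>2 \<le> 4\<^sup>2" using m by (intro power_mono) auto
    also have "\<dots> \<le> 1 / (54 * q)" using q0 q1 by (simp add: field_simps)
    finally have m2: "m\<^sup>2 \<le> 1 / (54 * q)" .
    have "1 / (54 * q) \<le> (\<integral>t. (gamma_kernel b x t)\<^sup>2 * base_density t \<partial>lborel) - m\<^sup>2"
    proof -
      have "1 / (27 * q) = 1 / (54 * q) + 1 / (54 * q)" using q0 by (simp add: field_simps)
      then show ?thesis using gamma_kernel_square_integral_ge[OF b(1) x] m2 by (simp add: q_def)
    qed
    then have "1 / (54 * q) / real n \<le> ((\<integral>t. (gamma_kernel b x t)\<^sup>2 * base_density t \<partial>lborel) - m\<^sup>2) / real n"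
      using n by (intro divide_right_mono) auto
    then have "ennreal ((1 / (54 * q) / real n) powr (p / 2)) \<le> pointwise_risk p n (gamma_kde n b) base_density x"
      using q0 p unfolding m_def
      by (intro pointwise_risk_gamma_kde_ge_variance b x0 prob_density_base_density n) auto
    moreover have "c * (1 / x) \<le> (1 / (54 * q) / real n) powr (p / 2)"
    proof -
      define s where "s = 54 * real n * sqrt b"
      have s: "0 < s" using n b by (simp add: s_def)
      have "1 / (54 * q) / real n = (1 / s) * (1 / sqrt x)" by (simp add: q_def s_def real_sqrt_mult)
      then have "(1 / (54 * q) / real n) powr (p / 2) = (1 / s) powr (p / 2) * (1 / sqrt x) powr (p / 2)"
        using s x0 by (simp only: powr_mult)
      also have "(1 / s) powr (p / 2) = c"
      proof -
        have "c = s powr (- (p / 2))" by (simp add: c_def s_def)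
        also have "\<dots> = (1 / s) powr (p / 2)" using s by (simp add: powr_minus_divide powr_divide)
        finally show ?thesis by simp
      qed
      also have "(1 / sqrt x) powr (p / 2) = (1 / x) powr (p / 4)"
        using x0 by (simp add: powr_half_sqrt[symmetric] powr_divide powr_powr)
      finally have e: "(1 / (54 * q) / real n) powr (p / 2) = c * (1 / x) powr (p / 4)" .
      have "(1 / x) powr 1 \<le> (1 / x) powr (p / 4)" using x x0 p by (intro powr_mono) auto
      then have "1 / x \<le> (1 / x) powr (p / 4)" using x0 by simp
      then show ?thesis unfolding e by (intro mult_left_mono) (auto simp: c_def)
    qed
    ultimately show ?thesis by (meson ennreal_leI order_trans)
  qed
  have "has_bochner_integral lborel (\<lambda>x. (1 / x) * indicator {b..1/8} x) (ln (1/8) - ln b)"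
    using b b8
    by (intro has_bochner_integral_FTC_Icc_nonneg)
      (auto intro!: derivative_eq_intros DERIV_isCont continuous_intros)
  from has_bochner_integral_mult_right[OF this, of c]
  have I: "has_bochner_integral lborel (\<lambda>x. c * ((1 / x) * indicator {b..1/8} x)) (c * ln (1 / (8 * b)))"
    using b by (simp add: ln_div ln_mult)
  then have "ennreal (c * ln (1 / (8 * b))) \<le> (\<integral>\<^sup>+x. ennreal (c * ((1 / x) * indicator {b..1/8} x)) \<partial>lborel)"
    using ennreal_integral_le[of lborel "\<lambda>x. c * ((1 / x) * indicator {b..1/8} x)"]
    by (simp add: has_bochner_integral_iff)
  also have "\<dots> \<le> (\<integral>\<^sup>+x\<in>{0..}. pointwise_risk p n (gamma_kde n b) base_density x \<partial>lborel)"
  proof (rule nn_integral_mono)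
    fix x :: real
    show "ennreal (c * ((1 / x) * indicator {b..1/8} x)) \<le> pointwise_risk p n (gamma_kde n b) base_density x * indicator {0..} x"
      using pt[of x] b by (cases "b \<le> x \<and> x \<le> 1/8") auto
  qed
  finally show "ennreal (((54 * real n * sqrt b) powr (- 1 / 2) * ln (1 / (8 * b)) powr (1 / p)) powr p)
    \<le> (\<integral>\<^sup>+x\<in>{0..}. pointwise_risk p n (gamma_kde n b) base_density x \<partial>lborel)"
    unfolding e .
qed (use p in auto)

section \<open>The rate of the gamma kernel estimator\<close>

text \<open>
  With \<open>y = n powr (2 / (2 \<beta> + 1))\<close> the bias bound suffices for \<open>b \<ge> A / y\<close>, and for smaller \<open>b\<close> the variance
  bound does. The constant \<open>A\<close> is chosen for the first case and \<open>D\<close> is the logarithmic factor that the second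
  case then requires.
\<close>

lemma gamma_kde_rate:
  assumes p: "4 \<le> p" and \<beta>: "0 < \<beta>" "\<beta> \<le> 2" and M: "0 < M"
  shows "\<exists>N. \<forall>n\<ge>N. \<forall>b. 0 < b \<longrightarrow> b < 1 \<longrightarrow>
    ennreal (M * real n powr (- \<beta> / (2 * \<beta> + 1))) \<le> max_risk p n (gamma_kde n b) (holder_class \<beta> 54)"
proof -
  define r where "r = 1 / (2 * \<beta> + 1)"
  have r: "0 < r" using \<beta> by (simp add: r_def)
  have rate: "- \<beta> / (2 * \<beta> + 1) = - (\<beta> * r)" by (simp add: r_def)
  define c where "c = 48 powr (- \<beta>) / (512 :: real)"
  have c: "0 < c" by (simp add: c_def)
  define A where "A = (M / c) powr (2 / \<beta>)"
  have A: "0 < A" using M c by (simp add: A_def)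
  have cA: "c * A powr (\<beta> / 2) = M" using M c \<beta> by (simp add: A_def powr_powr)
  define D where "D = M * sqrt (54 * sqrt A)"
  have D: "0 < D" using M A by (simp add: D_def)
  define E where "E = 10 ^ 6 * A + 8 * A * exp (D powr p)"
  have E: "10 ^ 6 * A \<le> E" "8 * A * exp (D powr p) \<le> E" "0 < E"
    using A by (auto simp: E_def add_pos_pos)
  define N where "N = nat \<lceil>E powr (1 / (2 * r))\<rceil> + 1"
  have "ennreal (M * real n powr (- \<beta> / (2 * \<beta> + 1))) \<le> max_risk p n (gamma_kde n b) (holder_class \<beta> 54)"
    if n: "N \<le> n" and b: "0 < b" "b < 1" for n b
  proof -
    have n0: "0 < n" using n by (simp add: N_def)
    define y where "y = real n powr (2 * r)"
    have y: "0 < y" using n0 by (simp add: y_def)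
    have yE: "E \<le> y"
    proof -
      have "E powr (1 / (2 * r)) \<le> real n" using n by (simp add: N_def) linarith
      then have "(E powr (1 / (2 * r))) powr (2 * r) \<le> y" unfolding y_def using r by (intro powr_mono2) auto
      then show ?thesis using E r by (simp add: powr_powr)
    qed
    have yr: "y powr s = real n powr (2 * r * s)" for s by (simp add: y_def powr_powr)
    show ?thesis
    proof (cases "A / y \<le> b")
      case True
      have "M * real n powr (- (\<beta> * r)) = c * (A / y) powr (\<beta> / 2)"
      proof -
        have "(A / y) powr (\<beta> / 2) = A powr (\<beta> / 2) * real n powr (- (\<beta> * r))"
        proof -
          have "y powr (\<beta> / 2) = real n powr (\<beta> * r)" unfolding yr by (simp add: mult.commute)
          then show ?thesis by (simp add: powr_divide powr_minus_divide)
        qed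
        then show ?thesis using cA by simp
      qed
      also have "\<dots> \<le> c * b powr (\<beta> / 2)"
        using True A y c \<beta> by (intro mult_left_mono powr_mono2) auto
      finally have "ennreal (M * real n powr (- (\<beta> * r))) \<le> ennreal (c * b powr (\<beta> / 2))"
        by (rule ennreal_leI)
      also have "\<dots> \<le> max_risk p n (gamma_kde n b) (holder_class \<beta> 54)"
        unfolding c_def using p by (intro gamma_kde_bias_lower_bound \<beta> n0 b) auto
      finally show ?thesis unfolding rate .
    next
      case False
      then have bA: "b < A / y" by simp
      have b6: "b \<le> 1 / 10 ^ 6"
      proof -
        have "A / y \<le> 1 / 10 ^ 6" using E(1) yE y by (simp add: field_simps)
        then show ?thesis using bA by linarith
      qed
      have "D \<le> ln (1 / (8 * b)) powr (1 / p)"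
      proof -
        have "exp (D powr p) \<le> y / (8 * A)" using E(2) yE A by (simp add: field_simps)
        also have "\<dots> \<le> 1 / (8 * b)" using bA b A y by (simp add: field_simps)
        finally have "D powr p \<le> ln (1 / (8 * b))" using b by (subst ln_ge_iff) auto
        then have "(D powr p) powr (1 / p) \<le> ln (1 / (8 * b)) powr (1 / p)"
          using p by (intro powr_mono2) auto
        then show ?thesis using D p by (simp add: powr_powr)
      qed
      moreover have "real n powr (- (\<beta> * r)) / sqrt (54 * sqrt A) \<le> (54 * real n * sqrt b) powr (- 1 / 2)"
      proof -
        have "sqrt b \<le> sqrt A * real n powr (- r)"
        proof -
          have "sqrt b \<le> sqrt (A / y)" using bA by simp
          also have "\<dots> = sqrt A / real n powr r"
            using y yr[of "1/2"] by (simp add: powr_half_sqrt real_sqrt_divide)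
          also have "\<dots> = sqrt A * real n powr (- r)" by (simp add: powr_minus_divide)
          finally show ?thesis .
        qed
        then have "54 * real n * sqrt b \<le> (54 * sqrt A) * (real n * real n powr (- r))"
          by (simp add: mult_left_mono mult_ac)
        also have "real n * real n powr (- r) = real n powr (1 - r)"
          using n0 by (simp add: powr_mult_base)
        finally have "((54 * sqrt A) * real n powr (1 - r)) powr (- 1 / 2) \<le> (54 * real n * sqrt b) powr (- 1 / 2)"
          using b n0 A by (intro powr_mono2') auto
        moreover have "((54 * sqrt A) * real n powr (1 - r)) powr (- 1 / 2)
            = real n powr (- (\<beta> * r)) / sqrt (54 * sqrt A)"
        proof -
          have "(1 - r) * (- 1 / 2) = - (\<beta> * r)" using \<beta> by (simp add: r_def field_simps)
          then have "(real n powr (1 - r)) powr (- 1 / 2) = real n powr (- (\<beta> * r))"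
            by (simp only: powr_powr)
          moreover have "(54 * sqrt A) powr (- 1 / 2) = 1 / sqrt (54 * sqrt A)"
          proof -
            have "(54 * sqrt A) powr (- (1 / 2)) = 1 / (54 * sqrt A) powr (1 / 2)" by (rule powr_minus_divide)
            then show ?thesis using A by (simp add: powr_half_sqrt)
          qed
          ultimately show ?thesis using A by (simp add: powr_mult)
        qed
        ultimately show ?thesis by simp
      qed
      ultimately have "real n powr (- (\<beta> * r)) / sqrt (54 * sqrt A) * D
          \<le> (54 * real n * sqrt b) powr (- 1 / 2) * ln (1 / (8 * b)) powr (1 / p)"
        using D by (intro mult_mono) auto
      moreover have "real n powr (- (\<beta> * r)) / sqrt (54 * sqrt A) * D = M * real n powr (- (\<beta> * r))"
        using A by (simp add: D_def)
      ultimately have "ennreal (M * real n powr (- (\<beta> * r)))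
          \<le> ennreal ((54 * real n * sqrt b) powr (- 1 / 2) * ln (1 / (8 * b)) powr (1 / p))"
        by (intro ennreal_leI) simp
      also have "\<dots> \<le> max_risk p n (gamma_kde n b) (holder_class \<beta> 54)"
        by (rule gamma_kde_variance_lower_bound[OF p \<beta> n0 b(1) b6])
      finally show ?thesis unfolding rate .
    qed
  qed
  then show ?thesis by blast
qed

lemma ennreal_le_divide:
  assumes "d \<le> ennreal u" "ennreal (k * u) \<le> a" "0 \<le> k" "0 < u"
  shows "ennreal k \<le> a / d"
proof (cases "d = 0")
  case True
  then show ?thesis using assms by (cases "k = 0") (auto simp: ennreal_divide_zero top_unique zero_less_iff_neq_zero intro: order_trans)
next
  case False
  have "d \<noteq> \<top>" using assms(1) by (auto simp: top_unique)
  have "ennreal k * d \<le> ennreal k * ennreal u" using assms(1) by (intro mult_left_mono) auto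
  also have "\<dots> \<le> a" using assms by (simp add: ennreal_mult)
  finally have "ennreal k * d / d \<le> a / d" by (rule divide_right_mono_ennreal)
  then show ?thesis using False \<open>d \<noteq> \<top>\<close> by (simp add: mult_divide_eq_ennreal)
qed

theorem proposition2:
  fixes p \<beta> :: real
  assumes "4 \<le> p" and "0 < \<beta>" and "\<beta> \<le> 2"
  shows "\<exists>L>1.
    (\<forall>\<^sub>F n in sequentially. 0 < minimax_risk p n (holder_class \<beta> L)) \<and>
    (\<forall>b :: nat \<Rightarrow> real. (\<forall>n. b n \<in> {0<..<1}) \<longrightarrow>
       liminf (\<lambda>n. max_risk p n (gamma_kde n (b n)) (holder_class \<beta> L)
                     / minimax_risk p n (holder_class \<beta> L)) = \<infinity>)"
proof (intro exI[of _ 54] conjI allI impI)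
  show "\<forall>\<^sub>F n in sequentially. 0 < minimax_risk p n (holder_class \<beta> 54)"
    using minimax_risk_pos[of p \<beta>] assms by simp
  fix b :: "nat \<Rightarrow> real" assume b: "\<forall>n. b n \<in> {0<..<1}"
  obtain C where C: "0 < C" "\<And>n. 1 \<le> n \<Longrightarrow>
      minimax_risk p n (holder_class \<beta> 54) \<le> ennreal (C * real n powr (- \<beta> / (2 * \<beta> + 1)))"
    using minimax_risk_upper_bound[of p \<beta> 54] assms by auto
  define R where "R n = max_risk p n (gamma_kde n (b n)) (holder_class \<beta> 54)
    / minimax_risk p n (holder_class \<beta> 54)" for n
  have ge: "ennreal k \<le> liminf R" if k: "0 < k" for k
  proof (rule Liminf_bounded)
    obtain N where N: "\<And>n b. N \<le> n \<Longrightarrow> 0 < b \<Longrightarrow> b < 1 \<Longrightarrow>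
        ennreal (k * C * real n powr (- \<beta> / (2 * \<beta> + 1))) \<le> max_risk p n (gamma_kde n b) (holder_class \<beta> 54)"
      using gamma_kde_rate[OF assms, of "k * C"] k C by auto
    have "ennreal k \<le> R n" if n: "max N 1 \<le> n" for n
      unfolding R_def
    proof (rule ennreal_le_divide)
      show "minimax_risk p n (holder_class \<beta> 54) \<le> ennreal (C * real n powr (- \<beta> / (2 * \<beta> + 1)))"
        using n by (intro C) auto
      show "ennreal (k * (C * real n powr (- \<beta> / (2 * \<beta> + 1)))) \<le> max_risk p n (gamma_kde n (b n)) (holder_class \<beta> 54)"
        using N[of n "b n"] n b by (simp add: mult.assoc)
    qed (use k C n in auto)
    then show "\<forall>\<^sub>F n in sequentially. ennreal k \<le> R n" by (rule eventually_sequentiallyI)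
  qed
  have "liminf R = \<infinity>"
  proof (rule ccontr)
    assume "liminf R \<noteq> \<infinity>"
    then obtain l where l: "liminf R = ennreal l" "0 \<le> l" by (cases "liminf R") auto
    then have "ennreal (l + 1) \<le> ennreal l" using ge[of "l + 1"] by simp
    then show False using l by (simp add: ennreal_le_iff)
  qed
  then show "liminf (\<lambda>n. max_risk p n (gamma_kde n (b n)) (holder_class \<beta> 54)
      / minimax_risk p n (holder_class \<beta> 54)) = \<infinity>"
    unfolding R_def .
qed simp

end
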